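(* Let $u\in\mathbb{F}_q[t]$ be a nonzero square-free polynomial, and let $g,h\in\mathbb{F}_q[t]$ with $g\neq 0$ and $\gcd(g,h)=1$. Then there are infinitely many square-free monic polynomials $w\in\mathbb{F}_q[t]$, all of whose irreducible monic factors are congruent to $h$ modulo $g$, such that $uw$ is a Carmichael polynomial.
   Context: $\mathbb{F}_q$ is the finite field with $q$ elements. A finite ring $S$ is a Carmichael ring if $S$ is not a field and $a^{|S|}=a$ for every $a\in S$. A polynomial $f\in\mathbb{F}_q[t]$ is a Carmichael polynomial if $\mathbb{F}_q[t]/(f)$ is a Carmichael ring (equivalently, for composite $f$: $f$ is square-free and $\deg P\mid \deg f$ for every irreducible factor $P$ of $f$). *)

theory Defs
  imports "HOL-Computational_Algebra.Computational_Algebra"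
begin

text \<open>The quotient ring F_q[t]/(f), represented by its canonical residues
  (polynomials a with a mod f = a), with arithmetic modulo f.\<close>

definition quot_carrier :: "'a::field poly \<Rightarrow> 'a poly set" where
  "quot_carrier f = {a. a mod f = a}"

definition quot_is_field :: "'a::field poly \<Rightarrow> bool" where
  "quot_is_field f \<longleftrightarrow> \<not> is_unit f \<and>
     (\<forall>a. a mod f \<noteq> 0 \<longrightarrow> (\<exists>b. (a * b) mod f = 1 mod f))"

text \<open>Carmichael ring S = F_q[t]/(f): S finite (f nonzero), S not a field, and a^|S| = a for all a in S.\<close>
definition carmichael_poly :: "'a::{field,finite} poly \<Rightarrow> bool" where
  "carmichael_poly f \<longleftrightarrow> f \<noteq> 0 \<and> \<not> quot_is_field f \<and>
     (\<forall>a. (a ^ card (quot_carrier f)) mod f = a mod f)"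

end

theory Submission
  imports "HOL-Algebra.Multiplicative_Group" "HOL-Library.Cardinality" Defs
begin

text \<open>
  Let \<open>q\<close> be the cardinality of the field. If, for every \<open>K\<close> and every large \<open>d\<close>, the residue class
  of \<open>h\<close> modulo \<open>g\<close> contains at least \<open>K d\<close> monic irreducible polynomials of degree \<open>d\<close>, then
  \<open>w\<close> can be taken as a product of such polynomials of the two coprime degrees \<open>d\<close> and \<open>d + 1\<close>, with
  the numbers of factors chosen such that \<open>deg (u w) = (deg u)! d (d + 1)\<close>; Fermat's theorem modulo
  each irreducible factor then makes \<open>u w\<close> a Carmichael polynomial.

  The irreducibles are counted with characters \<open>\<chi>\<close> modulo \<open>g\<close>. Put
  \<open>S\<^sub>d = \<Sum> deg P \<chi>(P)\<^sup>k\<close>, summed over \<open>k deg P = d\<close>. If \<open>\<chi>\<close> is not principal, its L-function is a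
  polynomial \<open>\<Prod>(1 - a\<^sub>i z)\<close>, so \<open>S\<^sub>d = - \<Sum> a\<^sub>i\<^sup>d\<close>, and \<open>S\<^sub>d = o(q\<^sup>d)\<close> once all \<open>|a\<^sub>i| < q\<close>.
  Suppose \<open>|a\<^sub>1| \<ge> q\<close>; a rotation makes \<open>a\<^sub>1 > 0\<close>. As \<open>|S\<^sub>d| \<le> q\<^sup>d\<close>, the power sums of the remaining
  \<open>a\<^sub>i\<close> have nonpositive real parts, hence by Newton's identities \<open>\<Prod>(1 - a\<^sub>i z)(1 - cnj a\<^sub>i z)\<close>,
  taken over \<open>i \<ge> 2\<close>, has nonnegative coefficients. It is a polynomial, so these real parts vanish
  for large \<open>d\<close>, which forces \<open>|a\<^sub>1| = q\<close> and \<open>S\<^sub>d = - a\<^sub>1\<^sup>d\<close>. Then the bound \<open>|S\<^sub>d| \<le> q\<^sup>d\<close> is attained,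
  so \<open>\<chi>(t)\<^sup>d = - (a\<^sub>1/q)\<^sup>d\<close> for all large \<open>d\<close>, which is absurd for the pair \<open>d, 2d\<close>.
\<close>

section \<open>Characters of finite abelian groups\<close>

text \<open>Values outside \<open>H\<close> are left free, so a character of a subgroup is a total
  function, and to extend it is to find another function that agrees with it on
  \<open>H\<close>.\<close>

definition multiplicative_on :: "('g, 'b) monoid_scheme \<Rightarrow> 'g set \<Rightarrow> ('g \<Rightarrow> complex) \<Rightarrow> bool" where
  "multiplicative_on G H \<chi> \<longleftrightarrow>
     \<chi> \<one>\<^bsub>G\<^esub> = 1 \<and> (\<forall>x\<in>H. \<forall>y\<in>H. \<chi> (x \<otimes>\<^bsub>G\<^esub> y) = \<chi> x * \<chi> y)"

lemma (in group) subgroup_nat_pow_closed: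
  assumes "subgroup H G" "x \<in> H"
  shows "x [^] (n::nat) \<in> H"
  using assms by (induction n) (auto intro: subgroup.one_closed subgroup.m_closed)

lemma (in group) multiplicative_on_pow:
  assumes "multiplicative_on G H \<chi>" "subgroup H G" "x \<in> H"
  shows "\<chi> (x [^] (n::nat)) = \<chi> x ^ n"
proof (induction n)
  case 0
  then show ?case using assms(1) by (simp add: multiplicative_on_def)
next
  case (Suc n)
  have "x [^] n \<in> H"
    using assms(2,3) by (rule subgroup_nat_pow_closed)
  then show ?case
    using assms(1,3) Suc by (simp add: multiplicative_on_def)
qed

text \<open>On the subgroup generated by \<open>H\<close> and \<open>a\<close> the extension must
  send \<open>a^n x\<close> to \<open>\<zeta>^n \<chi>(x)\<close>. This is well defined because
  minimality of \<open>k\<close> forces \<open>k\<close> to divide every \<open>n\<close> with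
  \<open>a^n\<close> in \<open>H\<close>, and for these \<open>\<chi>(a^n) = \<zeta>^n\<close>. The
  root \<open>\<zeta>\<close> is a parameter so that the value at \<open>a\<close> can be
  prescribed.\<close>

lemma (in comm_group) extend_character_by_element:
  assumes fin: "finite (carrier G)" and H: "subgroup H G" and \<chi>: "multiplicative_on G H \<chi>"
    and a: "a \<in> carrier G" and k: "k > 0" "a [^] k \<in> H"
    and min: "\<And>j. 0 < j \<Longrightarrow> j < k \<Longrightarrow> a [^] j \<notin> H"
    and \<zeta>: "\<zeta> ^ k = \<chi> (a [^] (k::nat))"
  obtains H' \<chi>' where "subgroup H' G" "multiplicative_on G H' \<chi>'" "H \<subseteq> H'" "a \<in> H'"
    "\<chi>' a = \<zeta>" "\<And>x. x \<in> H \<Longrightarrow> \<chi>' x = \<chi> x"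
proof -
  interpret H: subgroup H G by fact
  define H' where "H' = {a [^] n \<otimes> x | (n::nat) x. x \<in> H}"
  have one: "\<chi> \<one> = 1" and mult: "\<And>x y. x \<in> H \<Longrightarrow> y \<in> H \<Longrightarrow> \<chi> (x \<otimes> y) = \<chi> x * \<chi> y"
    using \<chi> by (auto simp: multiplicative_on_def)
  have Hc: "x \<in> carrier G" if "x \<in> H" for x
    using that by (rule H.mem_carrier)
  have pow_in_H: "\<chi> (a [^] n) = \<zeta> ^ n" if n: "a [^] n \<in> H" for n :: nat
  proof -
    have ks: "a [^] (k * s) \<in> H \<and> \<chi> (a [^] (k * s)) = \<zeta> ^ (k * s)" for s
      using multiplicative_on_pow[OF \<chi> H k(2), of s] subgroup_nat_pow_closed[OF H k(2), of s] a \<zeta>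
      by (simp add: nat_pow_pow power_mult)
    \<comment> \<open>Division with remainder: \<open>a^(n mod k)\<close> is a quotient of two
      elements of \<open>H\<close>, so \<open>n mod k = 0\<close> by minimality of
      \<open>k\<close>.\<close>
    have eq: "a [^] n = a [^] (k * (n div k)) \<otimes> a [^] (n mod k)"
      using a by (simp add: nat_pow_mult)
    then have "a [^] (n mod k) = inv (a [^] (k * (n div k))) \<otimes> a [^] n"
      using a by (simp flip: m_assoc)
    then have "a [^] (n mod k) \<in> H"
      using n ks by auto
    moreover have "n mod k < k" using k by simp
    ultimately have "n mod k = 0"
      using min[of "n mod k"] by auto
    then have "n = k * (n div k)" by auto
    then show ?thesis using ks[of "n div k"] by simp
  qed
  have wd_aux: "\<zeta> ^ n * \<chi> x = \<zeta> ^ l * \<chi> y"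
    if "a [^] n \<otimes> x = a [^] l \<otimes> y" "x \<in> H" "y \<in> H" "l \<le> n" for n l :: nat and x y
  proof -
    have "a [^] l \<otimes> (a [^] (n - l) \<otimes> x) = a [^] l \<otimes> y"
      using that a Hc by (simp flip: m_assoc add: nat_pow_mult)
    then have y: "a [^] (n - l) \<otimes> x = y"
      using that a Hc by (subst (asm) Units_l_cancel) (auto simp: Units_eq)
    then have "a [^] (n - l) = y \<otimes> inv x"
      using that a Hc by (metis inv_solve_right nat_pow_closed)
    then have in_H: "a [^] (n - l) \<in> H"
      using that by simp
    then have "\<chi> y = \<zeta> ^ (n - l) * \<chi> x"
      using mult[OF in_H \<open>x \<in> H\<close>] y pow_in_H[OF in_H] by simp
    then show ?thesis
      using \<open>l \<le> n\<close> by (simp flip: mult.assoc power_add)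
  qed
  have wd: "\<zeta> ^ n * \<chi> x = \<zeta> ^ l * \<chi> y"
    if "a [^] n \<otimes> x = a [^] l \<otimes> y" "x \<in> H" "y \<in> H" for n l :: nat and x y
    using wd_aux[of n x l y] wd_aux[of l y n x] that by (cases "l \<le> n") auto
  \<comment> \<open>By \<open>wd\<close> the value does not depend on the representation that
    \<open>SOME\<close> picks.\<close>
  define \<chi>' where "\<chi>' z = (case SOME (n, x). x \<in> H \<and> z = a [^] n \<otimes> x of (n::nat, x) \<Rightarrow> \<zeta> ^ n * \<chi> x)" for z
  have \<chi>': "\<chi>' (a [^] n \<otimes> x) = \<zeta> ^ n * \<chi> x" if "x \<in> H" for n :: nat and x
  proof -
    let ?P = "\<lambda>(l::nat, y). y \<in> H \<and> a [^] n \<otimes> x = a [^] l \<otimes> y"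
    obtain l y where ly: "(SOME p. ?P p) = (l, y)" by fastforce
    have "?P (SOME p. ?P p)"
      by (rule someI[of ?P "(n, x)"]) (use that in simp)
    then have "y \<in> H" "a [^] n \<otimes> x = a [^] l \<otimes> y" using ly by auto
    then show ?thesis unfolding \<chi>'_def ly using wd[of n x l y] that by simp
  qed
  show ?thesis
  proof
    show sub: "subgroup H' G"
    proof (rule subgroupI)
      show "H' \<subseteq> carrier G" using a Hc by (auto simp: H'_def)
      show "H' \<noteq> {}" using H.one_closed unfolding H'_def by blast
    next
      fix z assume "z \<in> H'"
      then obtain n :: nat and x where z: "z = a [^] n \<otimes> x" "x \<in> H" by (auto simp: H'_def)
      \<comment> \<open>\<open>H'\<close> is built from natural exponents only; as
        \<open>a^|G| = 1\<close>, the inverse of \<open>a^n\<close> is the power with exponent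
        \<open>n (|G| - 1)\<close>.\<close>
      have "Coset.order G > 0" using fin by (simp add: order_gt_0_iff_finite)
      then have "n * (Coset.order G - 1) + n = Coset.order G * n"
        by (cases "Coset.order G") auto
      then have "a [^] (n * (Coset.order G - 1)) \<otimes> a [^] n = \<one>"
        using a pow_order_eq_1[OF a] nat_pow_pow[OF a, of "Coset.order G" n] by (simp add: nat_pow_mult)
      then have "inv (a [^] n) = a [^] (n * (Coset.order G - 1))"
        using a by (simp add: inv_equality)
      then have "inv z = a [^] (n * (Coset.order G - 1)) \<otimes> inv x"
        using z a Hc by (simp add: inv_mult)
      then show "inv z \<in> H'" using z by (auto simp: H'_def)
    next
      fix z w assume "z \<in> H'" "w \<in> H'"
      then obtain n l :: nat and x y where z: "z = a [^] n \<otimes> x" "x \<in> H" "w = a [^] l \<otimes> y" "y \<in> H"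
        by (auto simp: H'_def)
      have "z \<otimes> w = a [^] (n + l) \<otimes> (x \<otimes> y)"
        using z a Hc by (simp add: m_ac flip: nat_pow_mult)
      then show "z \<otimes> w \<in> H'" using z by (auto simp: H'_def)
    qed
    show "multiplicative_on G H' \<chi>'"
      unfolding multiplicative_on_def
    proof (intro conjI ballI)
      show "\<chi>' \<one> = 1" using \<chi>'[of \<one> 0] one by simp
    next
      fix z w assume "z \<in> H'" "w \<in> H'"
      then obtain n l :: nat and x y where z: "z = a [^] n \<otimes> x" "x \<in> H" "w = a [^] l \<otimes> y" "y \<in> H"
        by (auto simp: H'_def)
      have "z \<otimes> w = a [^] (n + l) \<otimes> (x \<otimes> y)"
        using z a Hc by (simp add: m_ac flip: nat_pow_mult)
      then show "\<chi>' (z \<otimes> w) = \<chi>' z * \<chi>' w"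
        using z by (simp add: \<chi>' mult power_add)
    qed
    show "H \<subseteq> H'"
    proof
      fix x assume "x \<in> H"
      then have "x = a [^] (0::nat) \<otimes> x" using Hc by simp
      then show "x \<in> H'" using \<open>x \<in> H\<close> unfolding H'_def by blast
    qed
    have a1: "a = a [^] (1::nat) \<otimes> \<one>" using a by simp
    then show "a \<in> H'" unfolding H'_def using H.one_closed by blast
    show "\<chi>' a = \<zeta>" using \<chi>'[of \<one> 1] a one by simp
    show "\<chi>' x = \<chi> x" if "x \<in> H" for x
      using \<chi>'[of x 0] that Hc by simp
  qed
qed

text \<open>Elements are adjoined one at a time, by induction on the number of elements outside the
  subgroup; the root needed at each stage exists in the complex numbers.\<close>

lemma (in comm_group) extend_character:
  assumes fin: "finite (carrier G)" and "subgroup H G" and "multiplicative_on G H \<chi>"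
  obtains \<psi> where "multiplicative_on G (carrier G) \<psi>" "\<And>x. x \<in> H \<Longrightarrow> \<psi> x = \<chi> x"
proof -
  have "\<exists>\<psi>. multiplicative_on G (carrier G) \<psi> \<and> (\<forall>x\<in>H. \<psi> x = \<chi> x)"
    using assms(2,3)
  proof (induction "card (carrier G - H)" arbitrary: H \<chi> rule: less_induct)
    case less
    show ?case
    proof (cases "carrier G \<subseteq> H")
      case True
      then have "H = carrier G" using subgroup.subset[OF less(2)] by auto
      then show ?thesis using less(3) by blast
    next
      case False
      then obtain a where a: "a \<in> carrier G" "a \<notin> H" by blast
      define k where "k = (LEAST k::nat. 0 < k \<and> a [^] k \<in> H)"
      \<comment> \<open>\<open>a^|G| = 1\<close> lies in \<open>H\<close>, so the least exponent
        \<open>k\<close> exists.\<close>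
      have "0 < Coset.order G \<and> a [^] Coset.order G \<in> H"
        using a fin less(2) by (simp add: order_gt_0_iff_finite pow_order_eq_1 subgroup.one_closed)
      then have k: "0 < k \<and> a [^] k \<in> H" unfolding k_def by (rule LeastI)
      have min: "a [^] j \<notin> H" if "0 < j" "j < k" for j
        using that not_less_Least[of j "\<lambda>k. 0 < k \<and> a [^] k \<in> H"] unfolding k_def by auto
      obtain \<zeta> where \<zeta>: "\<zeta> ^ k = \<chi> (a [^] k)"
        using k nth_root_exists[of k "\<chi> (a [^] k)"] by metis
      obtain H' \<chi>' where *: "subgroup H' G" "multiplicative_on G H' \<chi>'" "H \<subseteq> H'" "a \<in> H'"
          "\<And>x. x \<in> H \<Longrightarrow> \<chi>' x = \<chi> x"
        using extend_character_by_element[OF fin less(2,3) a(1) _ _ min \<zeta>] k by metis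
      have "card (carrier G - H') < card (carrier G - H)"
        using fin * a by (intro psubset_card_mono) auto
      then show ?thesis
        using less(1)[OF _ *(1,2)] *(3,5) by (metis subsetD)
    qed
  qed
  then show ?thesis using that by blast
qed

text \<open>The trivial character of the trivial subgroup is extended to the powers of
  \<open>a\<close>, with a primitive root of unity of order \<open>ord a\<close> as the value at
  \<open>a\<close>, and from there to the whole group.\<close>

lemma (in comm_group) characters_separate_points:
  assumes fin: "finite (carrier G)" and a: "a \<in> carrier G" "a \<noteq> \<one>"
  obtains \<psi> where "multiplicative_on G (carrier G) \<psi>" "\<psi> a \<noteq> 1"
proof -
  define k where "k = ord a"
  have k: "0 < k" "a [^] k = \<one>"
    using a fin using ord_ge_1[OF fin] by (auto simp: k_def pow_ord_eq_1 Suc_le_eq)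
  have "k \<noteq> 1" using k a by auto
  with k have "k \<ge> 2" by linarith
  have min: "a [^] j \<notin> {\<one>}" if "0 < j" "j < k" for j
    using that a pow_eq_id[of a j] by (auto simp: k_def dest: dvd_imp_le)
  have triv: "multiplicative_on G {\<one>} (\<lambda>_. 1)"
    by (simp add: multiplicative_on_def)
  have \<zeta>: "cis (2 * pi / real k) ^ k = 1"
    using k by (simp add: DeMoivre)
  have "cis (2 * pi / real k) \<noteq> 1"
  proof
    assume "cis (2 * pi / real k) = 1"
    then have "cos (2 * pi / real k) = 1" by (metis cis.sel(1) one_complex.sel(1))
    then obtain n :: int where n: "2 * pi / real k = of_int n * 2 * pi"
      using cos_one_2pi_int by auto
    then have "1 / real k = of_int n" using k by (simp add: field_simps)
    then have "real_of_int n * real k = 1" using k by (simp add: field_simps)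
    then have "n * int k = 1" by (metis of_int_1 of_int_eq_iff of_int_mult of_int_of_nat_eq)
    then show False using \<open>k \<ge> 2\<close> by (simp add: zmult_eq_1_iff)
  qed
  then show ?thesis
    using extend_character_by_element[OF fin triv_subgroup triv a(1) k(1) _ min \<zeta>] k
      extend_character[OF fin] that by (metis singletonI)
qed

section \<open>Power sums of complex numbers\<close>

text \<open>The reflected polynomial is monic, its leading coefficient being the constant one of
  \<open>L\<close>, and splits over the complex numbers. Reflecting each factor back gives
  \<open>1 - a z\<close>, and reflecting twice returns \<open>L\<close> because its constant
  coefficient is nonzero.\<close>

lemma factor_poly_constant_coeff_1:
  fixes L :: "complex poly"
  assumes "coeff L 0 = 1"
  obtains as where "L = (\<Prod>a\<leftarrow>as. [:1, -a:])"
proof -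
  have L0: "L \<noteq> 0" using assms by auto
  define R where "R = reflect_poly L"
  have "R \<noteq> 0" using L0 by (simp add: R_def)
  have "lead_coeff R = 1"
    using assms by (metis R_def coeff_0_reflect_poly reflect_poly_reflect_poly zero_neq_one)
  then obtain A where A: "R = (\<Prod>x\<in>#A. [:-x, 1:])"
    using alg_closed_imp_factorization[OF \<open>R \<noteq> 0\<close>] by auto
  obtain as where as: "A = mset as" by (metis ex_mset)
  have R: "R = (\<Prod>a\<leftarrow>as. [:-a, 1:])"
    unfolding A as by (simp add: prod_mset_prod_list flip: mset_map)
  have "L = reflect_poly R" using assms by (simp add: R_def)
  also have "\<dots> = (\<Prod>a\<leftarrow>as. reflect_poly [:-a, 1:])"
    by (simp add: R reflect_poly_prod_list o_def)
  also have "(\<lambda>a::complex. reflect_poly [:-a, 1:]) = (\<lambda>a. [:1, -a:])"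
    by (auto simp: reflect_poly_def fun_eq_iff cCons_def)
  finally show ?thesis by (rule that)
qed

text \<open>The power series \<open>z P'(z) / P(z)\<close> for
  \<open>P = \<Prod>(1 - a z)\<close>.\<close>

definition log_deriv_coeffs :: "complex list \<Rightarrow> complex fps" where
  "log_deriv_coeffs as = Abs_fps (\<lambda>n. if n = 0 then 0 else - (\<Sum>a\<leftarrow>as. a ^ n))"

text \<open>Logarithmic differentiation turns the product into a sum, and multiplying through by the
  product avoids division. One factor contributes \<open>- a z / (1 - a z)\<close>, which is the
  fact \<open>G\<close> in the proof.\<close>

lemma fps_log_deriv_prod:
  "fps_X * fps_deriv (fps_of_poly (\<Prod>a\<leftarrow>as. [:1, -a:])) =
     log_deriv_coeffs as * fps_of_poly (\<Prod>a\<leftarrow>as. [:1, -a:])"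
proof (induction as)
  case Nil
  have "log_deriv_coeffs [] = 0" by (auto simp: log_deriv_coeffs_def fps_eq_iff)
  then show ?case by simp
next
  case (Cons a as)
  define P where "P = fps_of_poly (\<Prod>a\<leftarrow>as. [:1, -a:])"
  define G where "G = log_deriv_coeffs [a]"
  have split: "log_deriv_coeffs (a # as) = G + log_deriv_coeffs as"
    by (auto simp: G_def log_deriv_coeffs_def fps_eq_iff)
  have lin: "fps_of_poly [:1, -a:] = 1 - fps_const a * fps_X"
    by (simp add: fps_of_poly_pCons algebra_simps)
  have G: "(1 - fps_const a * fps_X) * G = - (fps_const a * fps_X)"
  proof (rule fps_ext)
    fix n
    have "fps_nth ((1 - fps_const a * fps_X) * G) n = fps_nth G n - a * (if n = 0 then 0 else fps_nth G (n - 1))"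
      by (simp add: algebra_simps)
    also have "\<dots> = fps_nth (- (fps_const a * fps_X)) n"
      by (cases n; cases "n - 1") (auto simp: G_def log_deriv_coeffs_def)
    finally show "fps_nth ((1 - fps_const a * fps_X) * G) n = fps_nth (- (fps_const a * fps_X)) n" .
  qed
  have "fps_X * fps_deriv ((1 - fps_const a * fps_X) * P) =
      (1 - fps_const a * fps_X) * (fps_X * fps_deriv P) - (fps_const a * fps_X) * P"
    by (simp add: algebra_simps)
  also have "\<dots> = (1 - fps_const a * fps_X) * (log_deriv_coeffs as * P) + ((1 - fps_const a * fps_X) * G) * P"
    using Cons.IH by (simp add: G P_def)
  also have "\<dots> = log_deriv_coeffs (a # as) * ((1 - fps_const a * fps_X) * P)"
    by (simp add: split algebra_simps)
  finally show ?case by (simp only: list.map prod_list.Cons fps_of_poly_mult lin P_def)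
qed

text \<open>Compare the coefficients of \<open>z^n\<close> on both sides of
  \<open>fps_log_deriv_prod\<close>.\<close>

lemma newton_identity:
  fixes as :: "complex list"
  defines "L \<equiv> (\<Prod>a\<leftarrow>as. [:1, -a:])"
  shows "of_nat n * coeff L n = - (\<Sum>j=1..n. (\<Sum>a\<leftarrow>as. a ^ j) * coeff L (n - j))"
proof (cases n)
  case (Suc k)
  have "of_nat n * coeff L n = fps_nth (fps_X * fps_deriv (fps_of_poly L)) n"
    using Suc by simp
  also have "\<dots> = (\<Sum>j=0..n. fps_nth (log_deriv_coeffs as) j * coeff L (n - j))"
    unfolding L_def fps_log_deriv_prod by (simp add: fps_mult_nth)
  also have "\<dots> = (\<Sum>j=1..n. fps_nth (log_deriv_coeffs as) j * coeff L (n - j))"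
    by (rule sum.mono_neutral_right) (auto simp: log_deriv_coeffs_def Suc_le_eq)
  also have "\<dots> = - (\<Sum>j=1..n. (\<Sum>a\<leftarrow>as. a ^ j) * coeff L (n - j))"
    by (simp add: log_deriv_coeffs_def sum_negf)
  finally show ?thesis .
qed simp

lemma degree_prod_linear_le:
  "degree (\<Prod>a\<leftarrow>as. [:1, - a :: complex:]) \<le> length as"
proof (induction as)
  case (Cons a as)
  have "degree ([:1, -a:] * (\<Prod>a\<leftarrow>as. [:1, -a:])) \<le> degree [:1, -a:] + degree (\<Prod>a\<leftarrow>as. [:1, -a:])"
    by (rule degree_mult_le)
  also have "\<dots> \<le> 1 + length as" using Cons by (intro add_mono) auto
  finally show ?case by simp
qed simp

lemma coeff_0_prod_linear: "coeff (\<Prod>a\<leftarrow>as. [:1, - a :: complex:]) 0 = 1"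
  by (induction as) (auto simp: coeff_mult)

text \<open>Together with its conjugates the list has real power sums \<open>- s j\<close> with
  \<open>s j \<ge> 0\<close>, so Newton's recurrence, started at \<open>coeff K 0 = 1\<close>,
  yields only nonnegative coefficients of \<open>K\<close>. Above the degree of \<open>K\<close>,
  which is at most \<open>2 * length bs\<close>, the recurrence equates a sum of nonnegative terms
  with 0, and its term of index \<open>d\<close> is \<open>s d\<close> itself.\<close>

lemma power_sums_Re_nonpos_imp_zero:
  fixes bs :: "complex list"
  assumes "\<And>d. d \<ge> 1 \<Longrightarrow> Re (\<Sum>b\<leftarrow>bs. b ^ d) \<le> 0"
  assumes "d > 2 * length bs"
  shows "Re (\<Sum>b\<leftarrow>bs. b ^ d) = 0"
proof -
  define as where "as = bs @ map cnj bs"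
  define K where "K = (\<Prod>a\<leftarrow>as. [:1, -a:])"
  define s where "s j = - 2 * Re (\<Sum>b\<leftarrow>bs. b ^ j)" for j
  have psum: "(\<Sum>a\<leftarrow>as. a ^ j) = of_real (- s j)" for j
  proof -
    have "(\<Sum>a\<leftarrow>map cnj bs. a ^ j) = cnj (\<Sum>b\<leftarrow>bs. b ^ j)"
      by (induction bs) auto
    then show ?thesis
      by (simp add: as_def s_def complex_add_cnj)
  qed
  have s: "s j \<ge> 0" if "j \<ge> 1" for j using assms(1)[OF that] by (simp add: s_def)
  have rec: "of_nat n * coeff K n = (\<Sum>j=1..n. of_real (s j) * coeff K (n - j))" for n
    using newton_identity[of n as] by (simp add: K_def psum sum_negf)
  have K0: "coeff K 0 = 1" by (simp add: K_def coeff_0_prod_linear)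
  have "\<exists>k\<ge>0. coeff K n = of_real k" for n
  proof (induction n rule: less_induct)
    case (less n)
    show ?case
    proof (cases "n = 0")
      case True
      then show ?thesis using K0 by (intro exI[of _ 1]) auto
    next
      case False
      have "\<forall>j\<in>{1..n}. \<exists>k\<ge>0. coeff K (n - j) = of_real k"
        using less False by auto
      then obtain k where k: "\<And>j. j \<in> {1..n} \<Longrightarrow> k j \<ge> 0 \<and> coeff K (n - j) = of_real (k j)"
        by metis
      have "of_nat n * coeff K n = (\<Sum>j=1..n. of_real (s j * k j))"
        unfolding rec by (intro sum.cong refl) (use k in auto)
      also have "\<dots> = of_real (\<Sum>j=1..n. s j * k j)" by simp
      finally have "coeff K n = of_real ((\<Sum>j=1..n. s j * k j) / real n)"
        using False by (simp add: field_simps)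
      moreover have "(\<Sum>j=1..n. s j * k j) / real n \<ge> 0"
        using k s by (intro divide_nonneg_nonneg sum_nonneg) auto
      ultimately show ?thesis by blast
    qed
  qed
  then obtain k where k: "\<And>n. k n \<ge> 0" "\<And>n. coeff K n = of_real (k n)" by metis
  have "degree K \<le> 2 * length bs"
    using degree_prod_linear_le[of as] by (simp add: K_def as_def)
  then have "coeff K d = 0" using assms(2) by (intro coeff_eq_0) auto
  then have "complex_of_real (\<Sum>j=1..d. s j * k (d - j)) = 0"
    using rec[of d] by (simp add: k(2))
  then have "(\<Sum>j=1..d. s j * k (d - j)) = 0" by (simp only: of_real_eq_0_iff)
  moreover have "\<forall>j\<in>{1..d}. 0 \<le> s j * k (d - j)" using s k by auto
  ultimately have "s d * k (d - d) = 0"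
    using assms(2) sum_nonneg_eq_0_iff[of "{1..d}" "\<lambda>j. s j * k (d - j)"] by auto
  moreover have "k 0 = 1" using k(2)[of 0] K0 by simp
  ultimately show ?thesis by (simp add: s_def)
qed

text \<open>After a rotation that makes \<open>a\<close> positive, the bound leaves no room for a
  positive real part in the power sums of the other entries. So these real parts vanish for large
  \<open>d\<close>, and the whole sum has real part equal to its largest possible modulus.\<close>

lemma power_sums_eq_dominant:
  fixes as :: "complex list"
  assumes a: "a \<in> set as" and bound: "\<And>d. d \<ge> 1 \<Longrightarrow> norm (\<Sum>b\<leftarrow>as. b ^ d) \<le> norm a ^ d"
    and d: "d > 2 * length as"
  shows "(\<Sum>b\<leftarrow>as. b ^ d) = a ^ d"
proof (cases "a = 0")
  case True
  then show ?thesis using bound[of d] d by (auto simp: power_0_left)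
next
  case False
  define \<theta> where "\<theta> = of_real (norm a) / a"
  have \<theta>: "norm \<theta> = 1" "\<theta> * a = of_real (norm a)"
    using False by (auto simp: \<theta>_def norm_divide)
  \<comment> \<open>\<open>remove1\<close> drops a single copy of \<open>a\<close>; further copies
    stay among the remaining entries.\<close>
  define bs where "bs = map (\<lambda>b. \<theta> * b) (remove1 a as)"
  have split: "\<theta> ^ j * (\<Sum>b\<leftarrow>as. b ^ j) = of_real (norm a ^ j) + (\<Sum>b\<leftarrow>bs. b ^ j)" for j
  proof -
    have "(\<Sum>b\<leftarrow>as. b ^ j) = a ^ j + (\<Sum>b\<leftarrow>remove1 a as. b ^ j)"
      using a by (simp add: sum_list_map_remove1)
    moreover have "\<theta> ^ j * (\<Sum>b\<leftarrow>xs. b ^ j) = (\<Sum>b\<leftarrow>map (\<lambda>b. \<theta> * b) xs. b ^ j)" for xs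
      by (induction xs) (auto simp: algebra_simps)
    moreover have "\<theta> ^ j * a ^ j = of_real (norm a ^ j)"
      by (metis \<theta>(2) of_real_power power_mult_distrib)
    ultimately show ?thesis by (simp add: bs_def algebra_simps)
  qed
  have le: "norm (of_real (norm a ^ j) + (\<Sum>b\<leftarrow>bs. b ^ j)) \<le> norm a ^ j" if "j \<ge> 1" for j
    unfolding split[symmetric] using bound[OF that] \<theta>(1) by (simp add: norm_mult norm_power)
  have "Re (\<Sum>b\<leftarrow>bs. b ^ j) \<le> 0" if "j \<ge> 1" for j
    using order_trans[OF complex_Re_le_cmod le[OF that]] by simp
  moreover have "length bs \<le> length as"
    by (simp add: bs_def length_remove1)
  ultimately have Re0: "Re (\<Sum>b\<leftarrow>bs. b ^ d) = 0"
    using power_sums_Re_nonpos_imp_zero[of bs d] d by auto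
  define z where "z = of_real (norm a ^ d) + (\<Sum>b\<leftarrow>bs. b ^ d)"
  \<comment> \<open>The real part already reaches the bound on the modulus, which leaves no
    imaginary part.\<close>
  have Re: "Re z = norm a ^ d" using Re0 by (simp add: z_def)
  have "norm z \<le> norm a ^ d" unfolding z_def using d by (intro le) auto
  then have "(norm z)\<^sup>2 \<le> (Re z)\<^sup>2" unfolding Re by (intro power_mono) auto
  then have "Im z = 0" by (simp add: cmod_power2)
  then have "z = of_real (norm a ^ d)" using Re by (simp add: complex_eq_iff)
  then have "\<theta> ^ d * (\<Sum>b\<leftarrow>as. b ^ d) = \<theta> ^ d * a ^ d"
    unfolding split z_def[symmetric] by (simp add: \<theta>(2) flip: power_mult_distrib)
  moreover have "\<theta> \<noteq> 0" using \<theta>(1) by auto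
  ultimately show ?thesis by simp
qed

section \<open>Monic polynomials over a finite field\<close>

text \<open>A condition on coefficients rather than on \<open>degree\<close>, so that 0 is included
  and \<open>n = 0\<close> gives exactly the zero polynomial.\<close>

definition low_degree_polys :: "nat \<Rightarrow> 'a::{field,finite} poly set" where
  "low_degree_polys n = {p. \<forall>i\<ge>n. coeff p i = 0}"

lemma card_low_degree_polys:
  "finite (low_degree_polys n :: 'a::{field,finite} poly set) \<and>
   card (low_degree_polys n :: 'a poly set) = CARD('a) ^ n"
proof (induction n)
  case 0
  have "low_degree_polys 0 = {0 :: 'a poly}"
    by (auto simp: low_degree_polys_def poly_eq_iff)
  then show ?case by simp
next
  case (Suc n)
  have eq: "(low_degree_polys (Suc n) :: 'a poly set) =
      (\<lambda>(a, p). pCons a p) ` (UNIV \<times> low_degree_polys n)"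
  proof (intro equalityI subsetI)
    fix p :: "'a poly" assume p: "p \<in> low_degree_polys (Suc n)"
    obtain a p' where p': "p = pCons a p'" by (cases p)
    have "p' \<in> low_degree_polys n"
      unfolding low_degree_polys_def
    proof (safe)
      fix i assume "i \<ge> n"
      then have "coeff p (Suc i) = 0" using p by (auto simp: low_degree_polys_def)
      then show "coeff p' i = 0" by (simp add: p')
    qed
    then show "p \<in> (\<lambda>(a, p). pCons a p) ` (UNIV \<times> low_degree_polys n)"
      using p' by auto
  next
    fix p :: "'a poly" assume "p \<in> (\<lambda>(a, p). pCons a p) ` (UNIV \<times> low_degree_polys n)"
    then show "p \<in> low_degree_polys (Suc n)"
      by (auto simp: low_degree_polys_def coeff_pCons split: nat.splits)
  qed
  have inj: "inj_on (\<lambda>(a, p). pCons a p) (UNIV \<times> low_degree_polys n :: ('a \<times> 'a poly) set)"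
    by (auto simp: inj_on_def)
  show ?case unfolding eq
    using Suc by (auto simp: card_image[OF inj] card_cartesian_product)
qed

lemma quot_carrier_eq_low_degree_polys:
  fixes f :: "'a::{field,finite} poly"
  assumes "f \<noteq> 0"
  shows "quot_carrier f = low_degree_polys (degree f)"
proof (intro equalityI subsetI)
  fix a :: "'a poly" assume "a \<in> quot_carrier f"
  then have "a = a mod f" by (simp add: quot_carrier_def)
  then have "a = 0 \<or> degree a < degree f"
    using degree_mod_less[OF assms, of a] by simp
  then show "a \<in> low_degree_polys (degree f)"
    by (auto simp: low_degree_polys_def intro: coeff_eq_0)
next
  fix a :: "'a poly" assume a: "a \<in> low_degree_polys (degree f)"
  have "a = 0 \<or> degree a < degree f"
  proof (rule ccontr)
    assume "\<not> (a = 0 \<or> degree a < degree f)"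
    then have "lead_coeff a = 0" "a \<noteq> 0" using a by (simp_all add: low_degree_polys_def)
    then show False by simp
  qed
  then show "a \<in> quot_carrier f"
    by (auto simp: quot_carrier_def mod_poly_less)
qed

lemma finite_quot_carrier: "f \<noteq> 0 \<Longrightarrow> finite (quot_carrier f)"
  and card_quot_carrier: "f \<noteq> 0 \<Longrightarrow> card (quot_carrier (f :: 'a::{field,finite} poly)) = CARD('a) ^ degree f"
  by (simp_all add: quot_carrier_eq_low_degree_polys card_low_degree_polys)

definition monics :: "nat \<Rightarrow> 'a::{field,finite} poly set" where
  "monics d = {f. lead_coeff f = 1 \<and> degree f = d}"

lemma monics_eq: "(monics d :: 'a::{field,finite} poly set) = (\<lambda>p. p + monom 1 d) ` low_degree_polys d"
proof (intro equalityI subsetI)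
  fix f :: "'a poly" assume f: "f \<in> monics d"
  have "f - monom 1 d \<in> low_degree_polys d"
    unfolding low_degree_polys_def
  proof safe
    fix i assume "i \<ge> d"
    then show "coeff (f - monom 1 d) i = 0"
      using f by (cases "i = d") (auto simp: monics_def coeff_eq_0)
  qed
  then show "f \<in> (\<lambda>p. p + monom 1 d) ` low_degree_polys d"
    by (intro image_eqI[of _ _ "f - monom 1 d"]) auto
next
  fix f :: "'a poly" assume "f \<in> (\<lambda>p. p + monom 1 d) ` low_degree_polys d"
  then obtain p where p: "f = p + monom 1 d" "p \<in> low_degree_polys d" by auto
  have lc: "coeff f d = 1" using p by (simp add: low_degree_polys_def)
  have "degree f \<le> d"
    using p by (intro degree_le) (auto simp: low_degree_polys_def)
  moreover have "d \<le> degree f" using lc by (intro le_degree) auto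
  ultimately show "f \<in> monics d" using lc by (auto simp: monics_def)
qed

lemma finite_monics: "finite (monics d :: 'a::{field,finite} poly set)"
  and card_monics: "card (monics d :: 'a::{field,finite} poly set) = CARD('a) ^ d"
proof -
  have inj: "inj_on (\<lambda>p. p + monom 1 d) (low_degree_polys d :: 'a poly set)"
    by (auto simp: inj_on_def)
  show "finite (monics d :: 'a poly set)" "card (monics d :: 'a poly set) = CARD('a) ^ d"
    unfolding monics_eq by (simp_all add: card_low_degree_polys card_image[OF inj])
qed

lemma monics_0: "monics 0 = {1}"
proof (intro equalityI subsetI)
  fix f :: "'a poly" assume "f \<in> monics 0"
  then have f: "degree f = 0" "lead_coeff f = 1" unfolding monics_def by auto
  obtain c where "f = [:c:]" using f(1) by (rule degree_eq_zeroE)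
  then show "f \<in> {1}" using f(2) by simp
qed (simp add: monics_def)

text \<open>Serves to translate the monic polynomials of degree \<open>d\<close> by residues modulo
  a polynomial of degree at most \<open>d\<close>.\<close>

lemma monics_add_low_degree:
  assumes "f \<in> monics d" "r \<in> low_degree_polys m" "m \<le> d"
  shows "f + r \<in> monics d"
proof -
  obtain p where p: "f = p + monom 1 d" "p \<in> low_degree_polys d"
    using assms(1) by (auto simp: monics_eq)
  have "p + r \<in> low_degree_polys d" using p assms by (auto simp: low_degree_polys_def)
  then show ?thesis unfolding monics_eq p by (intro image_eqI[of _ _ "p + r"]) auto
qed

lemma monics_nonzero: "f \<in> monics d \<Longrightarrow> f \<noteq> 0"
  by (auto simp: monics_def)

lemma monics_mult_iff:
  assumes "p \<in> monics e"
  shows "p * f \<in> monics (e + d) \<longleftrightarrow> f \<in> monics d"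
proof (cases "f = 0")
  case False
  then have "degree (p * f) = degree p + degree f"
    using monics_nonzero[OF assms] by (simp add: degree_mult_eq)
  moreover have "lead_coeff (p * f) = lead_coeff f"
    using assms unfolding lead_coeff_mult by (auto simp: monics_def)
  ultimately show ?thesis using assms by (auto simp: monics_def)
qed (use assms in \<open>auto simp: monics_def\<close>)

section \<open>Monic irreducibles and factorization\<close>

definition monic_irreducible :: "'a::{field,finite} poly \<Rightarrow> bool" where
  "monic_irreducible p \<longleftrightarrow> irreducible p \<and> lead_coeff p = 1"

lemma monic_irreducible_degree_pos:
  assumes "monic_irreducible p"
  shows "degree p > 0"
proof (rule ccontr)
  assume "\<not> degree p > 0"
  then have "p \<in> monics 0" using assms by (simp add: monics_def monic_irreducible_def)
  then show False using assms by (simp add: monics_0 monic_irreducible_def)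
qed

lemma monic_irreducible_in_monics: "monic_irreducible p \<Longrightarrow> p \<in> monics (degree p)"
  by (simp add: monic_irreducible_def monics_def)

lemma monic_irreducible_nonzero: "monic_irreducible p \<Longrightarrow> p \<noteq> 0"
  using monic_irreducible_in_monics monics_nonzero by blast

lemma monic_irreducible_not_unit: "monic_irreducible p \<Longrightarrow> \<not> is_unit p"
  unfolding monic_irreducible_def irreducible_def by blast

lemma monic_irreducible_power_in_monics:
  assumes "monic_irreducible p"
  shows "p ^ k \<in> monics (k * degree p)"
proof -
  have "degree (p ^ k) = k * degree p"
    using monic_irreducible_nonzero[OF assms] by (rule degree_power_eq)
  moreover have "lead_coeff (p ^ k) = 1"
    using assms by (simp add: monic_irreducible_def lead_coeff_power)
  ultimately show ?thesis unfolding monics_def by blast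
qed

lemma monic_irreducible_prime_elem: "monic_irreducible p \<Longrightarrow> prime_elem p"
  by (simp add: monic_irreducible_def field_poly_irreducible_imp_prime)

lemma monic_irreducible_dvd_imp_eq:
  assumes "monic_irreducible p" "monic_irreducible q" "p dvd q"
  shows "p = q"
proof -
  obtain r where r: "q = p * r" using assms(3) by auto
  have "\<not> is_unit p" "irreducible q"
    using assms monic_irreducible_not_unit by (auto simp: monic_irreducible_def)
  then have "is_unit r" using r unfolding irreducible_def by blast
  then obtain c where "r = [:c:]" by (metis is_unit_polyE)
  moreover have "lead_coeff r = 1"
    using assms r by (simp add: monic_irreducible_def lead_coeff_mult)
  ultimately show ?thesis using r by simp
qed

lemma exists_monic_irreducible_dvd:
  fixes f :: "'a::{field,finite} poly"
  assumes "degree f > 0"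
  shows "\<exists>p. monic_irreducible p \<and> p dvd f"
  using assms
proof (induction "degree f" arbitrary: f rule: less_induct)
  case less
  show ?case
  proof (cases "irreducible f")
    case True
    define p where "p = smult (inverse (lead_coeff f)) f"
    have nz: "lead_coeff f \<noteq> 0" using less by auto
    have "irreducible p"
    proof -
      have "p = [:inverse (lead_coeff f):] * f" by (simp add: p_def)
      moreover have "is_unit [:inverse (lead_coeff f):]"
        using nz by (simp add: is_unit_pCons_iff)
      ultimately show ?thesis using True by (simp only: irreducible_mult_unit_left)
    qed
    moreover have "lead_coeff p = 1" using nz by (simp add: p_def)
    moreover have "p dvd f" using nz by (simp add: p_def smult_dvd_iff)
    ultimately show ?thesis by (auto simp: monic_irreducible_def)
  next
    case False
    have "f \<noteq> 0" using less.prems by auto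
    then have "\<not> is_unit f" using less.prems by (simp add: is_unit_iff_degree)
    then obtain a b where ab: "f = a * b" "\<not> is_unit a" "\<not> is_unit b"
      using False \<open>f \<noteq> 0\<close> unfolding irreducible_def by blast
    then have "a \<noteq> 0" "b \<noteq> 0" using \<open>f \<noteq> 0\<close> by auto
    then have "degree a > 0" "degree b > 0" using ab by (auto simp: is_unit_iff_degree)
    moreover have "degree f = degree a + degree b"
      using ab \<open>a \<noteq> 0\<close> \<open>b \<noteq> 0\<close> by (simp add: degree_mult_eq)
    ultimately show ?thesis using less(1)[of a] ab by (auto intro: dvd_mult2)
  qed
qed

lemma prime_elem_power_dvd_mult:
  fixes p :: "'a::idom"
  assumes "prime_elem p" "\<not> p dvd q" "p ^ k dvd q * f"
  shows "p ^ k dvd f"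
  using assms(3)
proof (induction k arbitrary: f)
  case (Suc k)
  have "p dvd q * f" using Suc.prems unfolding power_Suc by (rule dvd_mult_left)
  then have "p dvd f" using assms(1,2) by (simp only: prime_elem_dvd_mult_iff simp_thms)
  then obtain f' where f': "f = p * f'" by auto
  have "p * p ^ k dvd p * (q * f')" using Suc.prems by (simp add: f' mult_ac)
  then have "p ^ k dvd q * f'"
    using prime_elem_not_zeroI[OF assms(1)] by (simp only: dvd_mult_cancel_left simp_thms)
  then have "p ^ k dvd f'" by (rule Suc.IH)
  then show ?case unfolding f' power_Suc by (rule mult_dvd_mono[OF dvd_refl])
qed simp

text \<open>An irreducible factor of multiplicity \<open>e\<close> occurs \<open>e\<close> times,
  with the exponents 1 to \<open>e\<close>. Summing \<open>degree p\<close> over the pairs therefore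
  gives \<open>degree f\<close>, the analogue of writing \<open>log n\<close> as a sum of von
  Mangoldt values over the divisors of \<open>n\<close>.\<close>

definition prime_power_divisors :: "'a::{field,finite} poly \<Rightarrow> ('a poly \<times> nat) set" where
  "prime_power_divisors f = {(p, k). monic_irreducible p \<and> k \<ge> 1 \<and> p ^ k dvd f}"

text \<open>Multiplication by \<open>q\<close> raises the multiplicity of \<open>q\<close> by one:
  the old exponents of \<open>q\<close> move up and the exponent 1 is filled anew.\<close>

lemma prime_power_divisors_mult:
  assumes q: "monic_irreducible q"
  shows "prime_power_divisors (q * f) =
     insert (q, 1) ((\<lambda>(p, k). (p, if p = q then Suc k else k)) ` prime_power_divisors f)"
    (is "_ = insert _ (?h ` _)")
proof (intro equalityI subsetI)
  have q0: "q \<noteq> 0" using q by (rule monic_irreducible_nonzero)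
  fix x assume "x \<in> prime_power_divisors (q * f)"
  then obtain p k where x: "x = (p, k)" "monic_irreducible p" "k \<ge> 1" "p ^ k dvd q * f"
    by (auto simp: prime_power_divisors_def)
  show "x \<in> insert (q, 1) (?h ` prime_power_divisors f)"
  proof (cases "p = q")
    case True
    show ?thesis
    proof (cases "k = 1")
      case False
      then obtain j where j: "k = Suc j" "j \<ge> 1" using x by (cases k) auto
      have "q ^ j dvd f" using x True q0 j by simp
      then have "(q, j) \<in> prime_power_divisors f" using q j by (auto simp: prime_power_divisors_def)
      then show ?thesis using x True j by force
    qed (use x True in auto)
  next
    case False
    then have "\<not> p dvd q" using monic_irreducible_dvd_imp_eq x q by blast
    then have "p ^ k dvd f"
      using prime_elem_power_dvd_mult[OF monic_irreducible_prime_elem] x by blast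
    then have "(p, k) \<in> prime_power_divisors f" using x by (auto simp: prime_power_divisors_def)
    then show ?thesis using x False by force
  qed
next
  fix x assume "x \<in> insert (q, 1) (?h ` prime_power_divisors f)"
  then consider "x = (q, 1)" | p k where "x = ?h (p, k)" "(p, k) \<in> prime_power_divisors f"
    by auto
  then show "x \<in> prime_power_divisors (q * f)"
  proof cases
    case 1
    then show ?thesis using q by (simp add: prime_power_divisors_def)
  next
    case 2
    then show ?thesis
      by (cases "p = q") (simp_all add: prime_power_divisors_def mult_dvd_mono)
  qed
qed

lemma sum_degree_prime_power_divisors:
  fixes f :: "'a::{field,finite} poly"
  assumes "f \<in> monics d"
  shows "finite (prime_power_divisors f) \<and> (\<Sum>(p, k)\<in>prime_power_divisors f. degree p) = d"
  using assms
proof (induction d arbitrary: f rule: less_induct)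
  case (less d)
  show ?case
  proof (cases "d = 0")
    case True
    have "\<not> p ^ k dvd 1" if "monic_irreducible p" "k \<ge> 1" for p :: "'a poly" and k
      using that monic_irreducible_not_unit[of p] by (simp add: is_unit_power_iff)
    then have "prime_power_divisors f = {}"
      using less True by (auto simp: monics_0 prime_power_divisors_def)
    then show ?thesis using True by simp
  next
    case False
    then obtain q where q: "monic_irreducible q" "q dvd f"
      using less exists_monic_irreducible_dvd[of f] by (auto simp: monics_def)
    then obtain f' where f: "f = q * f'" by auto
    have q': "q \<in> monics (degree q)" using q by (simp add: monic_irreducible_in_monics)
    have "degree q \<le> d"
      using less q False by (auto simp: monics_def intro: dvd_imp_degree_le)
    then obtain e where e: "d = degree q + e" using le_Suc_ex by blast
    then have f': "f' \<in> monics e" using less f monics_mult_iff[OF q'] by metis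
    have "e < d" using e monic_irreducible_degree_pos[OF q(1)] by simp
    note IH = less(1)[OF this f']
    let ?h = "\<lambda>(p, k). (p, if p = q then Suc k else k)"
    have inj: "inj_on ?h (prime_power_divisors f')"
      by (auto simp: inj_on_def split: if_splits)
    \<comment> \<open>Shifted exponents of \<open>q\<close> are at least 2, so the pair with
      exponent 1 is new and the sum grows by exactly \<open>degree q\<close>.\<close>
    have notin: "(q, 1) \<notin> ?h ` prime_power_divisors f'"
      by (auto simp: prime_power_divisors_def)
    have "(\<Sum>(p, k)\<in>?h ` prime_power_divisors f'. degree p) = (\<Sum>(p, k)\<in>prime_power_divisors f'. degree p)"
      by (subst sum.reindex[OF inj]) (auto intro!: sum.cong)
    then show ?thesis
      unfolding f prime_power_divisors_mult[OF q(1)] using IH notin e by auto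
  qed
qed

definition prime_powers :: "nat \<Rightarrow> ('a::{field,finite} poly \<times> nat) set" where
  "prime_powers j = {(p, k). monic_irreducible p \<and> k \<ge> 1 \<and> k * degree p = j}"

lemma finite_prime_powers: "finite (prime_powers j :: ('a::{field,finite} poly \<times> nat) set)"
proof (rule finite_subset)
  show "(prime_powers j :: ('a poly \<times> nat) set) \<subseteq> (\<Union>d\<le>j. monics d) \<times> {..j}"
  proof
    fix x :: "'a poly \<times> nat" assume "x \<in> prime_powers j"
    then obtain p k where x: "x = (p, k)" "monic_irreducible p" "k \<ge> 1" "k * degree p = j"
      by (auto simp: prime_powers_def)
    have "degree p \<le> j" "k \<le> j"
      using x monic_irreducible_degree_pos[of p] by auto
    then show "x \<in> (\<Union>d\<le>j. monics d) \<times> {..j}"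
      using x by (auto simp: monics_def monic_irreducible_def)
  qed
qed (simp add: finite_monics)

text \<open>The ambient finite set depends on \<open>d\<close> only, which makes it possible to
  interchange a sum over \<open>f\<close> with a sum over prime power divisors.\<close>

lemma prime_power_divisors_eq:
  assumes "f \<in> monics d"
  shows "prime_power_divisors f = {x \<in> (\<Union>j\<in>{1..d}. prime_powers j). fst x ^ snd x dvd f}"
proof (intro equalityI subsetI)
  fix x assume "x \<in> prime_power_divisors f"
  then obtain p k where x: "x = (p, k)" "monic_irreducible p" "k \<ge> 1" "p ^ k dvd f"
    by (auto simp: prime_power_divisors_def)
  have "degree (p ^ k) = k * degree p"
    using monic_irreducible_power_in_monics[of p k] x by (simp add: monics_def)
  moreover have "degree (p ^ k) \<le> d"
    using x assms by (auto simp: monics_def intro: dvd_imp_degree_le)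
  ultimately have "k * degree p \<in> {1..d}"
    using x monic_irreducible_degree_pos[of p] by auto
  then show "x \<in> {x \<in> (\<Union>j\<in>{1..d}. prime_powers j). fst x ^ snd x dvd f}"
    using x by (auto simp: prime_powers_def)
qed (auto simp: prime_powers_def prime_power_divisors_def)

section \<open>L-series of completely multiplicative functions\<close>

locale completely_multiplicative =
  fixes \<chi> :: "'a::{field,finite} poly \<Rightarrow> complex"
  assumes one: "\<chi> 1 = 1"
    and mult: "\<chi> (f * g) = \<chi> f * \<chi> g"
    and norm_le_1: "norm (\<chi> f) \<le> 1"
begin

lemma power: "\<chi> (f ^ n) = \<chi> f ^ n"
  by (induction n) (auto simp: one mult)

definition L_coeff :: "nat \<Rightarrow> complex" where
  "L_coeff d = (\<Sum>f\<in>monics d. \<chi> f)"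

text \<open>The coefficient of \<open>z^j\<close> in \<open>z L'(z) / L(z)\<close>, where
  \<open>L\<close> is the series with coefficients \<open>L_coeff\<close>.\<close>

definition prime_power_sum :: "nat \<Rightarrow> complex" where
  "prime_power_sum j = (\<Sum>(p, k)\<in>prime_powers j. of_nat (degree p) * \<chi> p ^ k)"

lemma L_coeff_0: "L_coeff 0 = 1"
  by (simp add: L_coeff_def monics_0 one)

lemma sum_multiples:
  assumes "p \<in> monics e" "e \<le> d"
  shows "(\<Sum>f | f \<in> monics d \<and> p dvd f. \<chi> f) = \<chi> p * L_coeff (d - e)"
proof -
  have "p \<noteq> 0" using assms monics_nonzero by blast
  then have inj: "inj_on ((*) p) (monics (d - e))" by (auto simp: inj_on_def)
  have "{f. f \<in> monics d \<and> p dvd f} = (*) p ` monics (d - e)"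
    using monics_mult_iff[OF assms(1), of _ "d - e"] assms(2) by (auto elim!: dvdE)
  then show ?thesis
    by (simp add: sum.reindex[OF inj] mult L_coeff_def sum_distrib_left)
qed

text \<open>The coefficients of \<open>z L' = (z L'/L) L\<close>, obtained by double counting: the
  weight \<open>d\<close> of each \<open>f\<close> is spread over its prime power divisors, and the
  multiples of a fixed \<open>p^k\<close> of degree \<open>j\<close> contribute
  \<open>\<chi>(p)^k\<close> times \<open>L_coeff (d - j)\<close>.\<close>

lemma L_coeff_recurrence:
  "of_nat d * L_coeff d = (\<Sum>j=1..d. prime_power_sum j * L_coeff (d - j))"
proof -
  let ?V = "\<Union>j\<in>{1..d}. prime_powers j :: ('a poly \<times> nat) set"
  have finV: "finite ?V" by (simp add: finite_prime_powers)
  have deg: "of_nat d = (\<Sum>x\<in>?V. if fst x ^ snd x dvd f then of_nat (degree (fst x)) else (0::complex))"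
    if "f \<in> monics d" for f
  proof -
    have "complex_of_nat d = (\<Sum>x\<in>prime_power_divisors f. of_nat (degree (fst x)))"
      using sum_degree_prime_power_divisors[OF that] by (simp add: case_prod_unfold flip: of_nat_sum)
    also have "\<dots> = (\<Sum>x\<in>?V. if fst x ^ snd x dvd f then of_nat (degree (fst x)) else 0)"
      unfolding prime_power_divisors_eq[OF that] using finV by (intro sum.inter_filter)
    finally show ?thesis .
  qed
  have "of_nat d * L_coeff d = (\<Sum>f\<in>monics d. of_nat d * \<chi> f)"
    by (simp add: L_coeff_def sum_distrib_left)
  also have "\<dots> = (\<Sum>f\<in>monics d. \<Sum>x\<in>?V. of_nat (degree (fst x)) * (if fst x ^ snd x dvd f then \<chi> f else 0))"
  proof (rule sum.cong[OF refl])
    fix f :: "'a poly" assume f: "f \<in> monics d"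
    show "of_nat d * \<chi> f = (\<Sum>x\<in>?V. of_nat (degree (fst x)) * (if fst x ^ snd x dvd f then \<chi> f else 0))"
      unfolding deg[OF f] sum_distrib_right by (intro sum.cong) auto
  qed
  also have "\<dots> = (\<Sum>x\<in>?V. of_nat (degree (fst x)) * (\<Sum>f\<in>monics d. if fst x ^ snd x dvd f then \<chi> f else 0))"
    by (subst sum.swap) (simp add: sum_distrib_left)
  also have "\<dots> = (\<Sum>j\<in>{1..d}. \<Sum>x\<in>prime_powers j.
      of_nat (degree (fst x)) * (\<Sum>f\<in>monics d. if fst x ^ snd x dvd f then \<chi> f else 0))"
    by (rule sum.UNION_disjoint) (simp_all add: finite_prime_powers, fastforce simp: prime_powers_def)
  also have "\<dots> = (\<Sum>j=1..d. prime_power_sum j * L_coeff (d - j))"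
  proof (intro sum.cong[OF refl])
    fix j assume j: "j \<in> {1..d}"
    have "(\<Sum>f\<in>monics d. if fst x ^ snd x dvd f then \<chi> f else 0) = \<chi> (fst x) ^ snd x * L_coeff (d - j)"
      if "x \<in> prime_powers j" for x
    proof -
      have "fst x ^ snd x \<in> monics j"
        using that monic_irreducible_power_in_monics[of "fst x" "snd x"] by (auto simp: prime_powers_def)
      then show ?thesis
        using sum_multiples[of "fst x ^ snd x" j d] j
        by (simp add: power finite_monics flip: sum.inter_filter)
    qed
    then show "(\<Sum>x\<in>prime_powers j.
        of_nat (degree (fst x)) * (\<Sum>f\<in>monics d. if fst x ^ snd x dvd f then \<chi> f else 0)) =
        prime_power_sum j * L_coeff (d - j)"
      by (simp add: prime_power_sum_def sum_distrib_right case_prod_unfold mult.assoc cong: sum.cong)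
  qed
  finally show ?thesis .
qed

text \<open>As \<open>L_coeff 0 = 1\<close>, the term \<open>j = d\<close> isolates
  \<open>s d\<close>, so the recurrence determines it from the earlier values. Any other solution of
  the recurrence is thereby an explicit formula for the prime power sums.\<close>

lemma prime_power_sum_unique:
  assumes "\<And>d. of_nat d * L_coeff d = (\<Sum>j=1..d. s j * L_coeff (d - j))" and "d \<ge> 1"
  shows "prime_power_sum d = s d"
  using assms(2)
proof (induction d rule: less_induct)
  case (less d)
  have "(\<Sum>j=1..d. prime_power_sum j * L_coeff (d - j)) = (\<Sum>j=1..d. s j * L_coeff (d - j))"
    using assms(1)[of d] L_coeff_recurrence[of d] by simp
  moreover have "{1..d} = insert d {1..<d}" using less by auto
  moreover have "(\<Sum>j=1..<d. prime_power_sum j * L_coeff (d - j)) = (\<Sum>j=1..<d. s j * L_coeff (d - j))"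
    using less by (intro sum.cong) auto
  ultimately show ?case by (simp add: L_coeff_0)
qed

end

text \<open>For the constant function 1 the series is \<open>1 / (1 - q z)\<close> with
  \<open>q\<close> the cardinality of the field, and the numbers \<open>q^j\<close> solve the
  recurrence: each of its \<open>d\<close> terms is \<open>q^d\<close>.\<close>

lemma sum_degree_prime_powers:
  assumes "d \<ge> 1"
  shows "(\<Sum>(p, k)\<in>(prime_powers d :: ('a::{field,finite} poly \<times> nat) set). degree p) = CARD('a) ^ d"
proof -
  interpret completely_multiplicative "\<lambda>_ :: 'a poly. 1"
    by unfold_locales auto
  have L: "L_coeff n = of_nat (CARD('a) ^ n)" for n
    by (simp add: L_coeff_def card_monics)
  have "prime_power_sum d = of_nat (CARD('a) ^ d)"
  proof (rule prime_power_sum_unique[OF _ assms])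
    fix d
    show "of_nat d * L_coeff d = (\<Sum>j=1..d. of_nat (CARD('a) ^ j) * L_coeff (d - j))"
      by (simp add: L flip: power_add)
  qed
  then have "of_nat (\<Sum>(p, k)\<in>(prime_powers d :: ('a poly \<times> nat) set). degree p) = complex_of_nat (CARD('a) ^ d)"
    by (simp add: prime_power_sum_def case_prod_unfold)
  then show ?thesis by (simp only: of_nat_eq_iff)
qed

section \<open>Decay of the prime power sums\<close>

lemma complex_Re_eq_1_imp_eq_1:
  assumes "norm (z::complex) \<le> 1" "Re z = 1"
  shows "z = 1"
proof -
  have "(norm z)\<^sup>2 \<le> 1" using assms(1) by (simp add: power_le_one_iff abs_square_le_1)
  then have "Im z = 0" using assms(2) by (simp add: cmod_power2)
  then show ?thesis using assms(2) by (simp add: complex_eq_iff)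
qed

text \<open>The equality case of the triangle inequality: multiplied by \<open>cnj t\<close>, the
  hypothesis says that the nonnegative numbers \<open>w y * (1 - Re (z y * cnj t))\<close> add up to
  0.\<close>

lemma weighted_sum_extremal_imp_eq:
  fixes w :: "'b \<Rightarrow> real" and z :: "'b \<Rightarrow> complex"
  assumes "finite A" and w: "\<And>x. x \<in> A \<Longrightarrow> w x \<ge> 0" and z: "\<And>x. x \<in> A \<Longrightarrow> norm (z x) \<le> 1"
    and t: "norm t = 1" and sum: "(\<Sum>x\<in>A. of_real (w x) * z x) = of_real (\<Sum>x\<in>A. w x) * t"
    and x: "x \<in> A" "w x > 0"
  shows "z x = t"
proof -
  have tt: "t * cnj t = 1" using t by (simp add: complex_norm_square[symmetric])
  have le: "norm (z y * cnj t) \<le> 1" if "y \<in> A" for y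
    using z[OF that] t by (simp add: norm_mult)
  have nonneg: "w y * (1 - Re (z y * cnj t)) \<ge> 0" if "y \<in> A" for y
    using w[OF that] order_trans[OF complex_Re_le_cmod le[OF that]] by simp
  have "(\<Sum>y\<in>A. w y * Re (z y * cnj t)) = Re ((\<Sum>y\<in>A. of_real (w y) * z y) * cnj t)"
    by (simp add: sum_distrib_right mult.assoc Re_sum)
  also have "\<dots> = (\<Sum>y\<in>A. w y)"
    unfolding sum by (simp add: mult.assoc tt del: of_real_sum)
  finally have "(\<Sum>y\<in>A. w y * (1 - Re (z y * cnj t))) = 0"
    by (simp only: right_diff_distrib sum_subtractf mult_1_right diff_self)
  then have "\<forall>y\<in>A. w y * (1 - Re (z y * cnj t)) = 0"
    using sum_nonneg_eq_0_iff[of A "\<lambda>y. w y * (1 - Re (z y * cnj t))"] assms(1) nonneg by blast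
  then have "w x * (1 - Re (z x * cnj t)) = 0" using x(1) by blast
  then have "Re (z x * cnj t) = 1" using x(2) by (simp del: times_complex.sel)
  then have "z x * cnj t = 1" using le[OF x(1)] complex_Re_eq_1_imp_eq_1 by blast
  then have "z x * (t * cnj t) = t" by (simp add: mult_ac)
  then show ?thesis using tt by simp
qed

context completely_multiplicative
begin

lemma norm_prime_power_sum_le:
  assumes "d \<ge> 1"
  shows "norm (prime_power_sum d) \<le> real (CARD('a) ^ d)"
proof -
  have "norm (prime_power_sum d) \<le> (\<Sum>x\<in>prime_powers d. norm (of_nat (degree (fst x)) * \<chi> (fst x) ^ snd x))"
    unfolding prime_power_sum_def case_prod_unfold by (rule norm_sum)
  also have "\<dots> \<le> (\<Sum>x\<in>(prime_powers d :: ('a poly \<times> nat) set). real (degree (fst x)))"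
    by (intro sum_mono) (auto simp: norm_mult norm_power intro!: mult_left_le power_le_one norm_le_1)
  also have "\<dots> = real (\<Sum>(p, k)\<in>(prime_powers d :: ('a poly \<times> nat) set). degree p)"
    by (simp add: case_prod_unfold)
  also have "\<dots> = real (CARD('a) ^ d)" by (simp only: sum_degree_prime_powers[OF assms])
  finally show ?thesis .
qed

text \<open>The sum would attain the bound \<open>q^d\<close>, so every summand would point in the
  same direction, in particular that of the \<open>d\<close>-th power of a polynomial of degree
  1.\<close>

lemma prime_power_sum_not_eventually_extremal:
  assumes a: "norm a = real CARD('a)" and ev: "\<And>d. d > N \<Longrightarrow> prime_power_sum d = - (a ^ d)"
  shows False
proof -
  \<comment> \<open>An irreducible of degree 1 has a power in every degree, so the same value
    \<open>\<chi> X\<close> is constrained for all large \<open>d\<close>.\<close>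
  define X where "X = ([:0, 1:] :: 'a poly)"
  have X: "monic_irreducible X" "degree X = 1"
    by (auto simp: X_def monic_irreducible_def irreducible_linear_field_poly)
  define b where "b = a / of_nat CARD('a)"
  have b: "norm b = 1" using a by (simp add: b_def norm_divide)
  have eq: "\<chi> X ^ d = - (b ^ d)" if "d > N" for d
  proof -
    have "d \<ge> 1" using that by simp
    have "(\<Sum>x\<in>prime_powers d. of_real (real (degree (fst x))) * \<chi> (fst x) ^ snd x) = prime_power_sum d"
      by (simp add: prime_power_sum_def case_prod_unfold)
    also have "\<dots> = of_real (real (CARD('a) ^ d)) * - (b ^ d)"
      using ev[OF that] by (simp add: b_def power_divide)
    also have "real (CARD('a) ^ d) = (\<Sum>x\<in>(prime_powers d :: ('a poly \<times> nat) set). real (degree (fst x)))"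
      unfolding sum_degree_prime_powers[OF \<open>d \<ge> 1\<close>, symmetric] by (simp add: case_prod_unfold)
    finally have sum: "(\<Sum>x\<in>prime_powers d. of_real (real (degree (fst x))) * \<chi> (fst x) ^ snd x) =
      of_real (\<Sum>x\<in>(prime_powers d :: ('a poly \<times> nat) set). real (degree (fst x))) * - (b ^ d)" .
    have "\<chi> (fst (X, d)) ^ snd (X, d) = - (b ^ d)"
      by (rule weighted_sum_extremal_imp_eq[OF finite_prime_powers _ _ _ sum])
        (use X b \<open>d \<ge> 1\<close> in \<open>auto simp: norm_power prime_powers_def intro!: power_le_one norm_le_1\<close>)
    then show ?thesis by simp
  qed
  \<comment> \<open>Squaring the identity for \<open>Suc N\<close> removes the sign, which
    contradicts the identity for \<open>2 * Suc N\<close>.\<close>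
  have "\<chi> X ^ (2 * Suc N) = (\<chi> X ^ Suc N) ^ 2" by (rule power_even_eq)
  also have "\<dots> = b ^ (2 * Suc N)"
    unfolding eq[of "Suc N", OF lessI] power2_minus by (rule power_even_eq[symmetric])
  finally have "b ^ (2 * Suc N) = - (b ^ (2 * Suc N))" using eq[of "2 * Suc N"] by simp
  then have "b ^ (2 * Suc N) = 0" by (simp only: eq_neg_iff_add_eq_0) (simp add: mult_2[symmetric])
  then show False using b by auto
qed

lemma prime_power_sum_decay:
  assumes "\<And>d. d \<ge> m \<Longrightarrow> L_coeff d = 0"
  obtains r C where "0 \<le> r" "r < real CARD('a)" "\<And>d. d \<ge> 1 \<Longrightarrow> norm (prime_power_sum d) \<le> C * r ^ d"
proof -
  define L where "L = (\<Sum>d<m. monom (L_coeff d) d)"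
  have L: "coeff L n = L_coeff n" for n
  proof -
    have "coeff L n = (\<Sum>d<m. if d = n then L_coeff d else 0)"
      by (simp add: L_def coeff_sum)
    also have "\<dots> = L_coeff n" using assms[of n] by (auto simp: not_less)
    finally show ?thesis .
  qed
  then obtain as where as: "L = (\<Prod>a\<leftarrow>as. [:1, -a:])"
    using factor_poly_constant_coeff_1[of L] by (auto simp: L_coeff_0)
  \<comment> \<open>Newton's identities for the polynomial \<open>L\<close> are the recurrence of
    the prime power sums.\<close>
  have S: "prime_power_sum d = - (\<Sum>a\<leftarrow>as. a ^ d)" if "d \<ge> 1" for d
  proof (rule prime_power_sum_unique[OF _ that])
    fix d
    show "of_nat d * L_coeff d = (\<Sum>j=1..d. - (\<Sum>a\<leftarrow>as. a ^ j) * L_coeff (d - j))"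
      using newton_identity[of d as] by (simp add: sum_negf flip: as L)
  qed
  have small: "norm a < real CARD('a)" if a: "a \<in> set as" for a
  proof (rule ccontr)
    assume "\<not> norm a < real CARD('a)"
    then have ge: "real CARD('a) \<le> norm a" by simp
    have ps: "norm (\<Sum>b\<leftarrow>as. b ^ d) \<le> real CARD('a) ^ d" if "d \<ge> 1" for d
      using norm_prime_power_sum_le[OF that] S[OF that] by simp
    have dom: "(\<Sum>b\<leftarrow>as. b ^ d) = a ^ d" if "d > 2 * length as" for d
    proof (rule power_sums_eq_dominant[OF a _ that])
      show "norm (\<Sum>b\<leftarrow>as. b ^ d) \<le> norm a ^ d" if "d \<ge> 1" for d
        using ps[OF that] power_mono[OF ge, of d] by simp
    qed
    define N where "N = 2 * length as"
    \<comment> \<open>At this index the whole power sum is the single power of \<open>a\<close>, so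
      the bound by \<open>q^d\<close> applies to \<open>a\<close> alone.\<close>
    have "norm a ^ Suc N \<le> real CARD('a) ^ Suc N"
      using ps[of "Suc N"] dom[of "Suc N"] by (simp add: N_def norm_power norm_mult)
    then have "norm a \<le> real CARD('a)" by (rule power_le_imp_le_base) simp
    then have "norm a = real CARD('a)" using ge by simp
    moreover have "prime_power_sum d = - (a ^ d)" if "d > N" for d
      using S[of d] dom[of d] that by (simp add: N_def)
    ultimately show False by (rule prime_power_sum_not_eventually_extremal)
  qed
  \<comment> \<open>The inserted 0 covers an empty list of inverse roots and makes \<open>r\<close>
    nonnegative.\<close>
  define r where "r = Max (insert 0 (norm ` set as))"
  have le: "norm a \<le> r" if "a \<in> set as" for a
    using that by (auto simp: r_def)
  have r: "0 \<le> r" "r < real CARD('a)"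
    using small by (auto simp: r_def)
  have "norm (prime_power_sum d) \<le> real (length as) * r ^ d" if "d \<ge> 1" for d
  proof -
    have "norm (\<Sum>a\<leftarrow>xs. a ^ d) \<le> real (length xs) * r ^ d" if "set xs \<subseteq> set as" for xs
      using that
    proof (induction xs)
      case (Cons x xs)
      have "norm (x ^ d) \<le> r ^ d"
        using Cons.prems le[of x] by (auto simp: norm_power intro!: power_mono)
      then show ?case
        using Cons norm_triangle_ineq[of "x ^ d" "\<Sum>a\<leftarrow>xs. a ^ d"] by (simp add: algebra_simps)
    qed simp
    then show ?thesis using S[OF that] by simp
  qed
  then show ?thesis using r that by blast
qed

end

section \<open>The unit group modulo a polynomial\<close>

lemma bezout_poly:
  fixes a g :: "'a::field poly"
  assumes "coprime a g"
  shows "\<exists>x y. x * a + y * g = 1"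
  using assms
\<comment> \<open>Euclid's algorithm. The measure puts \<open>g = 0\<close> strictly below the
  nonzero constants, which have the same \<open>degree\<close>.\<close>
proof (induction "if g = 0 then 0 else Suc (degree g)" arbitrary: a g rule: less_induct)
  case less
  show ?case
  proof (cases "g = 0")
    case True
    then have "is_unit a" using less.prems by simp
    then obtain x where "1 = a * x" by (rule dvdE)
    then show ?thesis using True by (intro exI[of _ x] exI[of _ 0]) (simp add: mult.commute)
  next
    case False
    have cop: "coprime g (a mod g)" using less.prems False by (simp add: coprime_commute)
    have "(if a mod g = 0 then 0 else Suc (degree (a mod g))) < (if g = 0 then 0 else Suc (degree g))"
      using False degree_mod_less[OF False, of a] by auto
    from less.hyps[OF this cop] obtain x y where xy: "x * g + y * (a mod g) = 1" by blast
    have "y * a = y * (a div g) * g + y * (a mod g)"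
      by (metis div_mult_mod_eq distrib_left mult.assoc)
    then have "y * a + (x - y * (a div g)) * g = 1"
      using xy by (simp add: left_diff_distrib add.commute)
    then show ?thesis by blast
  qed
qed

lemma coprime_iff_inverse_mod:
  fixes a g :: "'a::field poly"
  shows "coprime a g \<longleftrightarrow> (\<exists>b. (a * b) mod g = 1 mod g)"
proof
  assume "coprime a g"
  then obtain x y where "x * a + y * g = 1" using bezout_poly by blast
  then have "(a * x) mod g = 1 mod g"
    by (metis mod_mult_self1 mult.commute)
  then show "\<exists>b. (a * b) mod g = 1 mod g" by blast
next
  assume "\<exists>b. (a * b) mod g = 1 mod g"
  then obtain b where b: "g dvd a * b - 1" by (auto simp: mod_eq_dvd_iff)
  show "coprime a g"
  proof (rule coprimeI)
    fix c assume "c dvd a" "c dvd g"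
    then have "c dvd a * b" "c dvd a * b - 1"
      using b dvd_trans by (blast intro: dvd_mult2)+
    then have "c dvd a * b - (a * b - 1)" by (rule dvd_diff)
    then show "is_unit c" by simp
  qed
qed

lemma coprime_mult_poly:
  fixes a b g :: "'a::field poly"
  shows "coprime (a * b) g \<longleftrightarrow> coprime a g \<and> coprime b g"
proof
  assume "coprime (a * b) g"
  then show "coprime a g \<and> coprime b g"
    by (meson coprimeI coprime_common_divisor dvd_mult dvd_mult2)
next
  assume "coprime a g \<and> coprime b g"
  then obtain a' b' where ab: "(a * a') mod g = 1 mod g" "(b * b') mod g = 1 mod g"
    using coprime_iff_inverse_mod by blast
  have "(a * b * (a' * b')) mod g = ((a * a') mod g * ((b * b') mod g)) mod g"
    by (simp add: mod_mult_eq mult_ac)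
  also have "\<dots> = 1 mod g" unfolding ab by (simp add: mod_mult_eq)
  finally show "coprime (a * b) g" unfolding coprime_iff_inverse_mod[of "a * b"] by blast
qed

text \<open>The neutral element is \<open>1 mod g\<close> so that a nonzero constant
  \<open>g\<close> is covered: the only residue is then 0, and the group is trivial.\<close>

definition unit_group :: "'a::{field,finite} poly \<Rightarrow> 'a poly monoid" where
  "unit_group g = \<lparr>carrier = {a \<in> quot_carrier g. coprime a g},
     monoid.mult = (\<lambda>a b. (a * b) mod g), one = 1 mod g\<rparr>"

lemma mod_in_unit_group_iff:
  assumes "g \<noteq> 0"
  shows "a mod g \<in> carrier (unit_group g) \<longleftrightarrow> coprime a g"
  using assms by (simp add: unit_group_def quot_carrier_def)

lemma comm_group_unit_group:
  assumes g: "g \<noteq> 0"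
  shows "comm_group (unit_group g)"
proof (rule comm_groupI)
  fix x y assume xy: "x \<in> carrier (unit_group g)" "y \<in> carrier (unit_group g)"
  then show "x \<otimes>\<^bsub>unit_group g\<^esub> y \<in> carrier (unit_group g)"
    using g by (simp add: unit_group_def quot_carrier_def coprime_mult_poly)
  show "x \<otimes>\<^bsub>unit_group g\<^esub> y = y \<otimes>\<^bsub>unit_group g\<^esub> x"
    by (simp add: unit_group_def mult.commute)
next
  show "\<one>\<^bsub>unit_group g\<^esub> \<in> carrier (unit_group g)"
    using mod_in_unit_group_iff[OF g, of 1] by (simp add: unit_group_def)
next
  fix x y z
  show "x \<otimes>\<^bsub>unit_group g\<^esub> y \<otimes>\<^bsub>unit_group g\<^esub> z = x \<otimes>\<^bsub>unit_group g\<^esub> (y \<otimes>\<^bsub>unit_group g\<^esub> z)"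
    by (simp add: unit_group_def mod_mult_left_eq mod_mult_right_eq mult.assoc)
next
  fix x assume x: "x \<in> carrier (unit_group g)"
  then show "\<one>\<^bsub>unit_group g\<^esub> \<otimes>\<^bsub>unit_group g\<^esub> x = x"
    by (simp add: unit_group_def quot_carrier_def mod_mult_left_eq)
  obtain b where b: "(x * b) mod g = 1 mod g"
    using x coprime_iff_inverse_mod[of x g] by (auto simp: unit_group_def)
  then have bx: "(b * x) mod g = 1 mod g" by (simp add: mult.commute)
  then have "coprime b g" unfolding coprime_iff_inverse_mod by blast
  then have "b mod g \<in> carrier (unit_group g)" using mod_in_unit_group_iff[OF g] by blast
  moreover have "b mod g \<otimes>\<^bsub>unit_group g\<^esub> x = \<one>\<^bsub>unit_group g\<^esub>"
    using bx by (simp add: unit_group_def mod_mult_left_eq)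
  ultimately show "\<exists>y\<in>carrier (unit_group g). y \<otimes>\<^bsub>unit_group g\<^esub> x = \<one>\<^bsub>unit_group g\<^esub>" by blast
qed

lemma finite_unit_group: "g \<noteq> 0 \<Longrightarrow> finite (carrier (unit_group g))"
  by (simp add: unit_group_def finite_quot_carrier)

lemma unit_group_pow:
  "(a mod g) [^]\<^bsub>unit_group g\<^esub> (n::nat) = (a ^ n) mod g"
  by (induction n) (simp_all add: unit_group_def nat_pow_def mod_mult_eq mult.commute)

lemma euler_theorem_poly:
  assumes "g \<noteq> 0" "coprime a g"
  shows "(a ^ card (carrier (unit_group g))) mod g = 1 mod g"
proof -
  interpret G: comm_group "unit_group g" using assms(1) by (rule comm_group_unit_group)
  have "(a mod g) [^]\<^bsub>unit_group g\<^esub> Coset.order (unit_group g) = \<one>\<^bsub>unit_group g\<^esub>"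
    using assms by (intro G.pow_order_eq_1) (simp add: mod_in_unit_group_iff)
  then show ?thesis unfolding unit_group_pow Coset.order_def by (simp add: unit_group_def)
qed

section \<open>Characters modulo a polynomial\<close>

text \<open>Dirichlet characters modulo \<open>g\<close>, extended by 0. Going from
  \<open>\<psi>\<close> to \<open>\<chi>\<close> discards the arbitrary values of
  \<open>\<psi>\<close> outside the group, so each character is counted once.\<close>

definition poly_chars :: "'a::{field,finite} poly \<Rightarrow> ('a poly \<Rightarrow> complex) set" where
  "poly_chars g = {\<chi>. \<exists>\<psi>. multiplicative_on (unit_group g) (carrier (unit_group g)) \<psi> \<and>
     \<chi> = (\<lambda>f. if coprime f g then \<psi> (f mod g) else 0)}"

definition principal_char :: "'a::{field,finite} poly \<Rightarrow> 'a poly \<Rightarrow> complex" where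
  "principal_char g f = (if coprime f g then 1 else 0)"

context
  fixes g :: "'a::{field,finite} poly"
  assumes g: "g \<noteq> 0"
begin

lemma principal_char_in_poly_chars: "principal_char g \<in> poly_chars g"
  unfolding poly_chars_def principal_char_def
  by (auto intro!: exI[of _ "\<lambda>_. 1"] simp: multiplicative_on_def)

lemma poly_chars_mult_closed:
  assumes "\<chi>\<^sub>1 \<in> poly_chars g" "\<chi>\<^sub>2 \<in> poly_chars g"
  shows "(\<lambda>f. \<chi>\<^sub>1 f * \<chi>\<^sub>2 f) \<in> poly_chars g"
proof -
  obtain \<psi>\<^sub>1 \<psi>\<^sub>2 where \<psi>: "multiplicative_on (unit_group g) (carrier (unit_group g)) \<psi>\<^sub>1"
      "multiplicative_on (unit_group g) (carrier (unit_group g)) \<psi>\<^sub>2"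
      "\<chi>\<^sub>1 = (\<lambda>f. if coprime f g then \<psi>\<^sub>1 (f mod g) else 0)"
      "\<chi>\<^sub>2 = (\<lambda>f. if coprime f g then \<psi>\<^sub>2 (f mod g) else 0)"
    using assms unfolding poly_chars_def by blast
  have "multiplicative_on (unit_group g) (carrier (unit_group g)) (\<lambda>x. \<psi>\<^sub>1 x * \<psi>\<^sub>2 x)"
    using \<psi>(1,2) by (simp add: multiplicative_on_def mult_ac)
  then show ?thesis unfolding poly_chars_def \<psi>(3,4)
    by (intro CollectI exI[of _ "\<lambda>x. \<psi>\<^sub>1 x * \<psi>\<^sub>2 x"]) auto
qed

lemma poly_char_one: "\<chi> \<in> poly_chars g \<Longrightarrow> \<chi> 1 = 1"
  by (auto simp: poly_chars_def multiplicative_on_def unit_group_def)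

lemma poly_char_mod: "\<chi> \<in> poly_chars g \<Longrightarrow> \<chi> (f mod g) = \<chi> f"
  using g by (auto simp: poly_chars_def)

lemma poly_char_eq_0: "\<chi> \<in> poly_chars g \<Longrightarrow> \<not> coprime f g \<Longrightarrow> \<chi> f = 0"
  by (auto simp: poly_chars_def)

lemma poly_char_mult:
  assumes "\<chi> \<in> poly_chars g"
  shows "\<chi> (f * f') = \<chi> f * \<chi> f'"
proof (cases "coprime f g \<and> coprime f' g")
  case True
  obtain \<psi> where \<psi>: "multiplicative_on (unit_group g) (carrier (unit_group g)) \<psi>"
      "\<chi> = (\<lambda>f. if coprime f g then \<psi> (f mod g) else 0)"
    using assms unfolding poly_chars_def by blast
  have "(f * f') mod g = (f mod g) \<otimes>\<^bsub>unit_group g\<^esub> (f' mod g)"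
    by (simp add: unit_group_def mod_mult_eq)
  moreover have "f mod g \<in> carrier (unit_group g)" "f' mod g \<in> carrier (unit_group g)"
    using True g by (simp_all add: mod_in_unit_group_iff)
  ultimately have "\<psi> ((f * f') mod g) = \<psi> (f mod g) * \<psi> (f' mod g)"
    using \<psi>(1) by (simp add: multiplicative_on_def)
  then show ?thesis using True by (simp add: \<psi>(2) coprime_mult_poly)
next
  case False
  then show ?thesis using poly_char_eq_0[OF assms] coprime_mult_poly[of f f' g] by auto
qed

lemma poly_char_power: "\<chi> \<in> poly_chars g \<Longrightarrow> \<chi> (f ^ n) = \<chi> f ^ n"
  by (induction n) (auto simp: poly_char_one poly_char_mult)

lemma card_unit_group_pos: "card (carrier (unit_group g)) > 0"
proof -
  have "1 mod g \<in> carrier (unit_group g)" using g by (simp add: mod_in_unit_group_iff)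
  then show ?thesis using finite_unit_group[OF g] card_gt_0_iff by blast
qed

lemma poly_char_root_of_unity:
  assumes "\<chi> \<in> poly_chars g" "coprime f g"
  shows "\<chi> f ^ card (carrier (unit_group g)) = 1"
proof -
  have "\<chi> f ^ card (carrier (unit_group g)) = \<chi> (f ^ card (carrier (unit_group g)) mod g)"
    by (simp add: poly_char_mod[OF assms(1)] poly_char_power[OF assms(1)])
  also have "\<dots> = 1"
    unfolding euler_theorem_poly[OF g assms(2)] poly_char_mod[OF assms(1)] by (rule poly_char_one[OF assms(1)])
  finally show ?thesis .
qed

lemma norm_poly_char:
  assumes "\<chi> \<in> poly_chars g" "coprime f g"
  shows "norm (\<chi> f) = 1"
proof -
  have "norm (\<chi> f) ^ card (carrier (unit_group g)) = 1"
    using poly_char_root_of_unity[OF assms] by (metis norm_one norm_power)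
  then show ?thesis
    using power_eq_imp_eq_base[of "norm (\<chi> f)" "card (carrier (unit_group g))" 1] card_unit_group_pos by simp
qed

lemma completely_multiplicative_poly_char:
  assumes "\<chi> \<in> poly_chars g"
  shows "completely_multiplicative \<chi>"
proof
  fix f f' :: "'a poly"
  show "\<chi> 1 = 1" "\<chi> (f * f') = \<chi> f * \<chi> f'"
    using assms by (simp_all add: poly_char_one poly_char_mult)
  show "norm (\<chi> f) \<le> 1"
    using norm_poly_char[OF assms] poly_char_eq_0[OF assms] by (cases "coprime f g") auto
qed

text \<open>A character is determined by its values on the finite unit group, and these are roots of
  unity of bounded order.\<close>

lemma finite_poly_chars: "finite (poly_chars g)"
proof -
  let ?G = "carrier (unit_group g)"
  let ?R = "{z :: complex. z ^ card ?G = 1}"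
  have "poly_chars g \<subseteq> (\<lambda>\<psi> f. if coprime f g then \<psi> (f mod g) else 0) ` (?G \<rightarrow>\<^sub>E ?R)"
  proof
    fix \<chi> assume \<chi>: "\<chi> \<in> poly_chars g"
    have "restrict \<chi> ?G \<in> ?G \<rightarrow>\<^sub>E ?R"
      using poly_char_root_of_unity[OF \<chi>] by (auto simp: unit_group_def)
    moreover have "\<chi> = (\<lambda>f. if coprime f g then restrict \<chi> ?G (f mod g) else 0)"
      using mod_in_unit_group_iff[OF g] poly_char_mod[OF \<chi>] poly_char_eq_0[OF \<chi>] by auto
    ultimately show "\<chi> \<in> (\<lambda>\<psi> f. if coprime f g then \<psi> (f mod g) else 0) ` (?G \<rightarrow>\<^sub>E ?R)"
      by blast
  qed
  moreover have "finite (?G \<rightarrow>\<^sub>E ?R)"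
    using card_unit_group_pos finite_unit_group[OF g] by (intro finite_PiE finite_roots_unity) auto
  ultimately show ?thesis using finite_surj by blast
qed

lemma poly_chars_separate:
  assumes "coprime a g" "a mod g \<noteq> 1 mod g"
  obtains \<chi> where "\<chi> \<in> poly_chars g" "\<chi> a \<noteq> 1"
proof -
  interpret G: comm_group "unit_group g" using g by (rule comm_group_unit_group)
  have "a mod g \<in> carrier (unit_group g)" "a mod g \<noteq> \<one>\<^bsub>unit_group g\<^esub>"
    using assms g by (simp add: mod_in_unit_group_iff, simp add: unit_group_def)
  then obtain \<psi> where \<psi>: "multiplicative_on (unit_group g) (carrier (unit_group g)) \<psi>" "\<psi> (a mod g) \<noteq> 1"
    using G.characters_separate_points[OF finite_unit_group[OF g]] by metis
  show ?thesis
  proof (rule that)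
    show "(\<lambda>f. if coprime f g then \<psi> (f mod g) else 0) \<in> poly_chars g"
      using \<psi>(1) unfolding poly_chars_def by blast
  qed (use \<psi> assms in simp)
qed

text \<open>If \<open>a\<close> is not 1 modulo \<open>g\<close>, some character
  \<open>\<chi>\<^sub>1\<close> has a value other than 1 at \<open>a\<close>. Multiplication by it
  permutes the characters, so the sum is unchanged when multiplied by that value.\<close>

lemma sum_poly_chars:
  assumes a: "coprime a g"
  shows "(\<Sum>\<chi>\<in>poly_chars g. \<chi> a) = (if a mod g = 1 mod g then of_nat (card (poly_chars g)) else 0)"
proof (cases "a mod g = 1 mod g")
  case True
  have "\<chi> a = 1" if "\<chi> \<in> poly_chars g" for \<chi>
    using poly_char_mod[OF that, of a] poly_char_mod[OF that, of 1] True poly_char_one[OF that] by simp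
  then have "(\<Sum>\<chi>\<in>poly_chars g. \<chi> a) = (\<Sum>\<chi>\<in>poly_chars g. 1)" by (intro sum.cong) auto
  then show ?thesis using True by simp
next
  case False
  then obtain \<chi>\<^sub>1 where \<chi>\<^sub>1: "\<chi>\<^sub>1 \<in> poly_chars g" "\<chi>\<^sub>1 a \<noteq> 1"
    using poly_chars_separate[OF a] by blast
  let ?m = "\<lambda>\<chi> f. \<chi>\<^sub>1 f * \<chi> f"
  have inj: "inj_on ?m (poly_chars g)"
  proof (rule inj_onI, rule ext)
    fix \<chi> \<chi>' f assume h: "\<chi> \<in> poly_chars g" "\<chi>' \<in> poly_chars g" "?m \<chi> = ?m \<chi>'"
    show "\<chi> f = \<chi>' f"
    proof (cases "coprime f g")
      case True
      then have "\<chi>\<^sub>1 f \<noteq> 0" using norm_poly_char[OF \<chi>\<^sub>1(1)] by force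
      then show ?thesis using fun_cong[OF h(3), of f] by simp
    qed (simp add: poly_char_eq_0[OF h(1)] poly_char_eq_0[OF h(2)])
  qed
  have img: "?m ` poly_chars g = poly_chars g"
    using finite_poly_chars inj poly_chars_mult_closed[OF \<chi>\<^sub>1(1)] by (intro endo_inj_surj) auto
  have "(\<Sum>\<chi>\<in>poly_chars g. \<chi> a) = (\<Sum>\<chi>\<in>?m ` poly_chars g. \<chi> a)" by (simp only: img)
  also have "\<dots> = \<chi>\<^sub>1 a * (\<Sum>\<chi>\<in>poly_chars g. \<chi> a)"
    by (simp add: sum.reindex[OF inj] sum_distrib_left)
  finally show ?thesis using \<chi>\<^sub>1(2) False by simp
qed

text \<open>With \<open>h'\<close> inverse to \<open>h\<close> modulo \<open>g\<close>,
  \<open>cnj (\<chi> h)\<close> is \<open>\<chi> h'\<close>, which reduces the claim to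
  \<open>sum_poly_chars\<close> at \<open>h' * a\<close>.\<close>

lemma poly_chars_orthogonality:
  assumes h: "coprime h g"
  shows "(\<Sum>\<chi>\<in>poly_chars g. cnj (\<chi> h) * \<chi> a) =
     (if a mod g = h mod g then of_nat (card (poly_chars g)) else 0)"
proof (cases "coprime a g")
  case False
  then have "a mod g \<noteq> h mod g" using h g by (metis coprime_mod_left_iff)
  moreover have "(\<Sum>\<chi>\<in>poly_chars g. cnj (\<chi> h) * \<chi> a) = 0"
    using poly_char_eq_0 False by (intro sum.neutral) simp
  ultimately show ?thesis by simp
next
  case True
  obtain h' where h': "(h * h') mod g = 1 mod g"
    using h unfolding coprime_iff_inverse_mod by blast
  then have "(h' * h) mod g = 1 mod g" by (simp add: mult.commute)
  then have h'_cop: "coprime h' g" unfolding coprime_iff_inverse_mod by blast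
  have cnj: "cnj (\<chi> h) = \<chi> h'" if \<chi>: "\<chi> \<in> poly_chars g" for \<chi>
  proof -
    have "\<chi> h * \<chi> h' = 1"
      using poly_char_mod[OF \<chi>, of "h * h'"] poly_char_mod[OF \<chi>, of 1] h'
        poly_char_one[OF \<chi>] poly_char_mult[OF \<chi>, of h h'] by simp
    moreover have "\<chi> h * cnj (\<chi> h) = 1"
      using norm_poly_char[OF \<chi> h] by (simp add: complex_norm_square[symmetric])
    ultimately show ?thesis by (metis mult_cancel_left mult_zero_left zero_neq_one)
  qed
  have "(\<Sum>\<chi>\<in>poly_chars g. cnj (\<chi> h) * \<chi> a) = (\<Sum>\<chi>\<in>poly_chars g. \<chi> (h' * a))"
    by (intro sum.cong) (simp_all add: cnj poly_char_mult)
  also have "\<dots> = (if (h' * a) mod g = 1 mod g then of_nat (card (poly_chars g)) else 0)"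
    using True h'_cop by (intro sum_poly_chars) (simp add: coprime_mult_poly)
  also have "(h' * a) mod g = 1 mod g \<longleftrightarrow> a mod g = h mod g"
  proof
    assume "(h' * a) mod g = 1 mod g"
    then have "(h * (h' * a)) mod g = h mod g" by (metis mod_mult_right_eq mult.right_neutral)
    moreover have "(h * h' * a) mod g = a mod g" by (metis h' mod_mult_left_eq mult.left_neutral)
    ultimately show "a mod g = h mod g" by (simp add: mult.assoc)
  next
    assume "a mod g = h mod g"
    then have "(h' * a) mod g = (h' * h) mod g" by (metis mod_mult_right_eq)
    then show "(h' * a) mod g = 1 mod g" using h' by (simp add: mult.commute)
  qed
  finally show ?thesis .
qed

text \<open>Multiplication by a unit \<open>b\<close> with \<open>\<chi> b \<noteq> 1\<close>
  permutes the residues and multiplies the sum by \<open>\<chi> b\<close>.\<close>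

lemma sum_residues_nonprincipal:
  assumes \<chi>: "\<chi> \<in> poly_chars g" and "\<chi> \<noteq> principal_char g"
  shows "(\<Sum>r\<in>quot_carrier g. \<chi> r) = 0"
proof -
  obtain b where b: "\<chi> b \<noteq> principal_char g b" using assms(2) by blast
  then have b_cop: "coprime b g" and b1: "\<chi> b \<noteq> 1"
    using poly_char_eq_0[OF \<chi>, of b] by (auto simp: principal_char_def split: if_splits)
  obtain b' where b': "(b * b') mod g = 1 mod g"
    using b_cop unfolding coprime_iff_inverse_mod by blast
  let ?m = "\<lambda>r. (b * r) mod g"
  have inj: "inj_on ?m (quot_carrier g)"
  proof (rule inj_onI)
    fix r s assume rs: "r \<in> quot_carrier g" "s \<in> quot_carrier g" "?m r = ?m s"
    have *: "(b' * ?m r) mod g = r mod g" for r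
    proof -
      have "(b' * ?m r) mod g = ((b * b') mod g * r) mod g"
        by (simp add: mod_mult_left_eq mod_mult_right_eq mult_ac)
      also have "\<dots> = r mod g" unfolding b' by (simp add: mod_mult_left_eq)
      finally show ?thesis .
    qed
    show "r = s" using *[of r] *[of s] rs by (simp add: quot_carrier_def)
  qed
  have img: "?m ` quot_carrier g = quot_carrier g"
    using inj finite_quot_carrier[OF g] by (intro endo_inj_surj) (auto simp: quot_carrier_def)
  have "(\<Sum>r\<in>quot_carrier g. \<chi> r) = (\<Sum>r\<in>?m ` quot_carrier g. \<chi> r)" by (simp only: img)
  also have "\<dots> = \<chi> b * (\<Sum>r\<in>quot_carrier g. \<chi> r)"
    by (simp add: sum.reindex[OF inj] sum_distrib_left poly_char_mod[OF \<chi>] poly_char_mult[OF \<chi>])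
  finally show ?thesis using b1 by simp
qed

text \<open>Translation by a residue permutes the monics of degree \<open>d \<ge> degree g\<close>,
  while for fixed \<open>f\<close> the translates \<open>f + r\<close> meet every residue class
  once. Summing over both in either order gives a multiple of the sum on one side and 0 on the
  other. Hence the L-series of \<open>\<chi>\<close> is a polynomial.\<close>

lemma sum_monics_nonprincipal:
  assumes \<chi>: "\<chi> \<in> poly_chars g" and np: "\<chi> \<noteq> principal_char g" and d: "d \<ge> degree g"
  shows "(\<Sum>f\<in>monics d. \<chi> f) = 0"
proof -
  let ?Q = "quot_carrier g"
  have shift_monics: "(\<Sum>f\<in>monics d. \<chi> (f + r)) = (\<Sum>f\<in>monics d. \<chi> f)" if r: "r \<in> ?Q" for r
  proof -
    have inj: "inj_on (\<lambda>f. f + r) (monics d)" by (auto simp: inj_on_def)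
    have "r \<in> low_degree_polys (degree g)" using r g by (simp add: quot_carrier_eq_low_degree_polys)
    then have "(\<lambda>f. f + r) ` monics d = monics d"
      using inj finite_monics d monics_add_low_degree by (intro endo_inj_surj) blast+
    then show ?thesis using sum.reindex[OF inj, of \<chi>] by simp
  qed
  have shift_residues: "(\<Sum>r\<in>?Q. \<chi> (f + r)) = 0" for f
  proof -
    have inj: "inj_on (\<lambda>r. (f + r) mod g) ?Q"
    proof (rule inj_onI)
      fix r s assume rs: "r \<in> ?Q" "s \<in> ?Q" "(f + r) mod g = (f + s) mod g"
      then have "g dvd r - s" by (simp add: mod_eq_dvd_iff)
      then have "r mod g = s mod g" by (simp add: mod_eq_dvd_iff)
      then show "r = s" using rs by (simp add: quot_carrier_def)
    qed
    have img: "(\<lambda>r. (f + r) mod g) ` ?Q = ?Q"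
      using inj finite_quot_carrier[OF g] by (intro endo_inj_surj) (auto simp: quot_carrier_def)
    have "(\<Sum>r\<in>?Q. \<chi> (f + r)) = (\<Sum>r\<in>?Q. \<chi> ((f + r) mod g))" by (simp only: poly_char_mod[OF \<chi>])
    also have "\<dots> = (\<Sum>r\<in>?Q. \<chi> r)" using sum.reindex[OF inj, of \<chi>] img by simp
    also have "\<dots> = 0" by (rule sum_residues_nonprincipal[OF \<chi> np])
    finally show ?thesis .
  qed
  have "of_nat (card ?Q) * (\<Sum>f\<in>monics d. \<chi> f) = (\<Sum>r\<in>?Q. \<Sum>f\<in>monics d. \<chi> (f + r))"
    by (simp add: shift_monics)
  also have "\<dots> = (\<Sum>f\<in>monics d. \<Sum>r\<in>?Q. \<chi> (f + r))" by (rule sum.swap)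
  also have "\<dots> = 0" by (simp add: shift_residues)
  finally show ?thesis using card_quot_carrier[OF g] by simp
qed

end

section \<open>Irreducible polynomials in residue classes\<close>

lemma irreducible_imp_coprime:
  fixes p g :: "'a::field poly"
  assumes "irreducible p" "\<not> p dvd g"
  shows "coprime p g"
proof (rule coprimeI)
  fix c assume c: "c dvd p" "c dvd g"
  then obtain e where e: "p = c * e" by auto
  then have "is_unit c \<or> is_unit e" using assms(1) unfolding irreducible_def by blast
  then show "is_unit c"
    using assms(2) c(2) mult_unit_dvd_iff[of e c g] e by auto
qed

lemma inj_on_fst_prime_powers: "inj_on fst (prime_powers d)"
proof (rule inj_onI)
  fix x y :: "'a poly \<times> nat"
  assume xy: "x \<in> prime_powers d" "y \<in> prime_powers d" "fst x = fst y"
  then have "snd x * degree (fst x) = snd y * degree (fst x)" "monic_irreducible (fst x)"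
    by (auto simp: prime_powers_def)
  moreover from this(2) have "degree (fst x) > 0" by (rule monic_irreducible_degree_pos)
  ultimately have "snd x = snd y" by simp
  then show "x = y" using xy(3) by (simp add: prod_eq_iff)
qed

definition irreducibles_in_class :: "'a::{field,finite} poly \<Rightarrow> 'a poly \<Rightarrow> nat \<Rightarrow> 'a poly set" where
  "irreducibles_in_class g h d = {p. monic_irreducible p \<and> degree p = d \<and> p mod g = h mod g}"

lemma finite_irreducibles_in_class: "finite (irreducibles_in_class g h d)"
  by (rule finite_subset[OF _ finite_monics[of d]])
    (auto simp: irreducibles_in_class_def monic_irreducible_def monics_def)

text \<open>The analogue of the von Mangoldt sum over a residue class, restricted to prime powers of
  degree exactly \<open>d\<close>.\<close>

definition class_weight :: "'a::{field,finite} poly \<Rightarrow> 'a poly \<Rightarrow> nat \<Rightarrow> nat" where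
  "class_weight g h d = (\<Sum>x | x \<in> prime_powers d \<and> (fst x ^ snd x) mod g = h mod g. degree (fst x))"

text \<open>Pairs with exponent 1 are the irreducibles of degree \<open>d\<close> in the class. In
  all other pairs the irreducible has degree at most \<open>d div 2\<close> and determines its
  exponent, so these pairs are few. Every pair has weight at most \<open>d\<close>.\<close>

lemma class_weight_le:
  fixes g h :: "'a::{field,finite} poly"
  shows "class_weight g h d \<le> d * card (irreducibles_in_class g h d) + d * (d + 1) * CARD('a) ^ (d div 2)"
proof -
  let ?I = "irreducibles_in_class g h d"
  define A where "A = {x. x \<in> prime_powers d \<and> (fst x ^ snd x) mod g = h mod g}"
  define B where "B = {x \<in> A. snd x \<ge> 2}"
  have finA: "finite A" by (rule finite_subset[OF _ finite_prime_powers[of d]]) (auto simp: A_def)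
  have sub: "A \<subseteq> (\<lambda>p. (p, 1)) ` ?I \<union> B"
  proof
    fix x assume x: "x \<in> A"
    show "x \<in> (\<lambda>p. (p, 1)) ` ?I \<union> B"
    proof (cases "snd x \<ge> 2")
      case False
      then have "snd x = 1" using x by (auto simp: A_def prime_powers_def)
      then have "fst x \<in> ?I" using x by (auto simp: A_def prime_powers_def irreducibles_in_class_def)
      moreover have "x = (fst x, 1)" using \<open>snd x = 1\<close> by (simp add: prod_eq_iff)
      ultimately show ?thesis by blast
    qed (use x in \<open>simp add: B_def\<close>)
  qed
  have cardB: "card B \<le> (d + 1) * CARD('a) ^ (d div 2)"
  proof -
    have "B \<subseteq> prime_powers d" by (auto simp: A_def B_def)
    then have "card B = card (fst ` B)"
      using inj_on_subset[OF inj_on_fst_prime_powers] by (metis card_image)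
    also have "fst ` B \<subseteq> (\<Union>e\<le>d div 2. monics e)"
    proof
      fix p assume "p \<in> fst ` B"
      then obtain k where k: "monic_irreducible p" "k \<ge> 2" "k * degree p = d"
        by (auto simp: A_def B_def prime_powers_def)
      have "2 * degree p \<le> d" unfolding k(3)[symmetric] using k(2) by (rule mult_le_mono1)
      then show "p \<in> (\<Union>e\<le>d div 2. monics e)"
        using monic_irreducible_in_monics[OF k(1)] by auto
    qed
    then have "card (fst ` B) \<le> card (\<Union>e\<le>d div 2. monics e :: 'a poly set)"
      by (intro card_mono) (simp_all add: finite_monics)
    also have "\<dots> \<le> (\<Sum>e\<le>d div 2. card (monics e :: 'a poly set))" by (rule card_UN_le) simp
    also have "\<dots> \<le> (\<Sum>e\<le>d div 2. CARD('a) ^ (d div 2))"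
      by (intro sum_mono) (auto simp: card_monics intro!: power_increasing)
    also have "\<dots> \<le> (d + 1) * CARD('a) ^ (d div 2)" by simp
    finally show ?thesis .
  qed
  have deg: "degree (fst x) \<le> d" if "x \<in> A" for x
    using that by (auto simp: A_def prime_powers_def)
  have "class_weight g h d = (\<Sum>x\<in>A. degree (fst x))" by (simp add: class_weight_def A_def)
  also have "\<dots> \<le> card A * d" using deg by (simp add: sum_bounded_above[where K = d, simplified])
  also have "card A \<le> card ((\<lambda>p. (p, 1::nat)) ` ?I) + card B"
    using finA by (intro order_trans[OF card_mono[OF _ sub] card_Un_le])
      (auto simp: B_def finite_irreducibles_in_class)
  also have "\<dots> \<le> card ?I + (d + 1) * CARD('a) ^ (d div 2)"
    using cardB card_image_le[OF finite_irreducibles_in_class] by (intro add_mono) auto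
  finally show ?thesis by (simp add: algebra_simps)
qed

context
  fixes g h :: "'a::{field,finite} poly"
  assumes g: "g \<noteq> 0" and h: "coprime h g"
begin

lemma prime_power_sum_poly_char:
  assumes "\<chi> \<in> poly_chars g"
  shows "completely_multiplicative.prime_power_sum \<chi> d =
    (\<Sum>x\<in>prime_powers d. of_nat (degree (fst x)) * \<chi> (fst x ^ snd x))"
  using completely_multiplicative.prime_power_sum_def[OF completely_multiplicative_poly_char[OF g assms]]
  by (simp add: case_prod_unfold poly_char_power[OF g assms])

text \<open>Orthogonality singles out the prime powers in the class of \<open>h\<close> once the two
  sums are interchanged.\<close>

lemma class_weight_eq_sum_chars:
  "of_nat (card (poly_chars g)) * of_nat (class_weight g h d) =
    (\<Sum>\<chi>\<in>poly_chars g. cnj (\<chi> h) * completely_multiplicative.prime_power_sum \<chi> d)"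
proof -
  let ?n = "of_nat (card (poly_chars g)) :: complex"
  have "(\<Sum>\<chi>\<in>poly_chars g. cnj (\<chi> h) * completely_multiplicative.prime_power_sum \<chi> d) =
      (\<Sum>\<chi>\<in>poly_chars g. \<Sum>x\<in>prime_powers d. of_nat (degree (fst x)) * (cnj (\<chi> h) * \<chi> (fst x ^ snd x)))"
    by (intro sum.cong refl) (simp add: prime_power_sum_poly_char sum_distrib_left mult_ac)
  also have "\<dots> = (\<Sum>x\<in>prime_powers d. of_nat (degree (fst x)) *
      (\<Sum>\<chi>\<in>poly_chars g. cnj (\<chi> h) * \<chi> (fst x ^ snd x)))"
    by (subst sum.swap) (simp add: sum_distrib_left)
  also have "\<dots> = (\<Sum>x\<in>prime_powers d. if (fst x ^ snd x) mod g = h mod g then of_nat (degree (fst x)) * ?n else 0)"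
    unfolding poly_chars_orthogonality[OF g h] by (intro sum.cong) auto
  also have "\<dots> = (\<Sum>x | x \<in> prime_powers d \<and> (fst x ^ snd x) mod g = h mod g. of_nat (degree (fst x)) * ?n)"
    by (rule sum.inter_filter[symmetric, OF finite_prime_powers])
  also have "\<dots> = ?n * of_nat (class_weight g h d)"
    by (simp add: class_weight_def sum_distrib_left mult.commute)
  finally show ?thesis by simp
qed

text \<open>The sum falls short of \<open>q^d\<close> only through powers of the irreducible
  divisors of \<open>g\<close>, and each of these has at most one power of degree \<open>d\<close>.
  So \<open>B\<close> can be taken as the sum of the degrees of these divisors.\<close>

lemma principal_prime_power_sum_ge:
  obtains B where "\<And>d. d \<ge> 1 \<Longrightarrow>
    Re (completely_multiplicative.prime_power_sum (principal_char g) d) \<ge> real (CARD('a) ^ d) - B"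
proof
  let ?D = "{p. monic_irreducible p \<and> p dvd g}"
  fix d :: nat assume d: "d \<ge> 1"
  have finD: "finite ?D"
  proof (rule finite_subset)
    show "?D \<subseteq> (\<Union>e\<le>degree g. monics e)"
      using g monic_irreducible_in_monics dvd_imp_degree_le by blast
  qed (simp add: finite_monics)
  define N where "N = {x \<in> prime_powers d. \<not> coprime (fst x) g}"
  have finN: "finite N" by (simp add: N_def finite_prime_powers)
  have N: "fst ` N \<subseteq> ?D"
  proof
    fix p assume "p \<in> fst ` N"
    then have p: "monic_irreducible p" "\<not> coprime p g" by (auto simp: N_def prime_powers_def)
    then have "p dvd g"
      using irreducible_imp_coprime[of p g] by (auto simp: monic_irreducible_def)
    then show "p \<in> ?D" using p by simp
  qed
  have inj: "inj_on fst N" by (rule inj_on_subset[OF inj_on_fst_prime_powers]) (auto simp: N_def)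
  have "(\<Sum>x\<in>N. degree (fst x)) = (\<Sum>p\<in>fst ` N. degree p)"
    using sum.reindex[OF inj, of degree] by simp
  also have "\<dots> \<le> (\<Sum>p\<in>?D. degree p)" using N finD by (intro sum_mono2) auto
  finally have NB: "(\<Sum>x\<in>N. real (degree (fst x))) \<le> real (\<Sum>p\<in>?D. degree p)"
    by (metis of_nat_le_iff of_nat_sum)
  have "completely_multiplicative.prime_power_sum (principal_char g) d =
      (\<Sum>x\<in>prime_powers d. of_nat (degree (fst x)) * principal_char g (fst x ^ snd x))"
    by (rule prime_power_sum_poly_char[OF principal_char_in_poly_chars[OF g]])
  also have "\<dots> = (\<Sum>x\<in>prime_powers d. of_real (real (degree (fst x)) - (if x \<in> N then real (degree (fst x)) else 0)))"
  proof (intro sum.cong refl)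
    fix x :: "'a poly \<times> nat" assume x: "x \<in> prime_powers d"
    then have "snd x > 0" by (auto simp: prime_powers_def)
    then have "principal_char g (fst x ^ snd x) = (if x \<in> N then 0 else 1)"
      using x unfolding poly_char_power[OF g principal_char_in_poly_chars[OF g]]
      by (auto simp: N_def principal_char_def)
    then show "of_nat (degree (fst x)) * principal_char g (fst x ^ snd x) =
       of_real (real (degree (fst x)) - (if x \<in> N then real (degree (fst x)) else 0))" by simp
  qed
  finally have "Re (completely_multiplicative.prime_power_sum (principal_char g) d) =
      (\<Sum>x\<in>(prime_powers d :: ('a poly \<times> nat) set). real (degree (fst x)) - (if x \<in> N then real (degree (fst x)) else 0))"
    by (simp flip: of_real_sum)
  also have "\<dots> = (\<Sum>x\<in>(prime_powers d :: ('a poly \<times> nat) set). real (degree (fst x))) - (\<Sum>x\<in>N. real (degree (fst x)))"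
  proof -
    have "N = {x \<in> prime_powers d. x \<in> N}" by (auto simp: N_def)
    then have "(\<Sum>x\<in>prime_powers d. if x \<in> N then real (degree (fst x)) else 0) = (\<Sum>x\<in>N. real (degree (fst x)))"
      using sum.inter_filter[OF finite_prime_powers[of d], of "\<lambda>x. real (degree (fst x))" "\<lambda>x. x \<in> N"] by simp
    then show ?thesis by (simp add: sum_subtractf)
  qed
  also have "(\<Sum>x\<in>(prime_powers d :: ('a poly \<times> nat) set). real (degree (fst x))) = real (CARD('a) ^ d)"
    using sum_degree_prime_powers[OF d, where 'a = 'a] by (simp add: case_prod_unfold flip: of_nat_sum)
  finally show "real (CARD('a) ^ d) - real (\<Sum>p\<in>?D. degree p) \<le>
      Re (completely_multiplicative.prime_power_sum (principal_char g) d)" using NB by simp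
qed

lemma nonprincipal_prime_power_sum_tendsto_0:
  assumes \<chi>: "\<chi> \<in> poly_chars g" and np: "\<chi> \<noteq> principal_char g"
  shows "(\<lambda>d. norm (completely_multiplicative.prime_power_sum \<chi> d) / real (CARD('a) ^ d)) \<longlonglongrightarrow> 0"
proof -
  interpret completely_multiplicative \<chi> by (rule completely_multiplicative_poly_char[OF g \<chi>])
  obtain r C where r: "0 \<le> r" "r < real CARD('a)"
      and C: "\<And>d. d \<ge> 1 \<Longrightarrow> norm (prime_power_sum d) \<le> C * r ^ d"
    using prime_power_sum_decay[of "degree g"] sum_monics_nonprincipal[OF g \<chi> np]
    unfolding L_coeff_def by metis
  show ?thesis
  proof (rule tendsto_sandwich[where f = "\<lambda>_. 0"])
    show "(\<lambda>d. C * (r / real CARD('a)) ^ d) \<longlonglongrightarrow> 0"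
      using r by (intro tendsto_mult_right_zero LIMSEQ_realpow_zero) auto
    show "\<forall>\<^sub>F d in sequentially. norm (prime_power_sum d) / real (CARD('a) ^ d) \<le> C * (r / real CARD('a)) ^ d"
      using eventually_ge_at_top[of "1::nat"]
      by eventually_elim (use C in \<open>simp add: power_divide divide_right_mono\<close>)
  qed simp_all
qed

text \<open>The principal character contributes about \<open>q^d\<close> to the class weight, the
  others \<open>o(q^d)\<close>, and proper prime powers only about \<open>d^2 q^(d/2)\<close>. What
  remains for the irreducibles exceeds \<open>K d^2\<close> for large \<open>d\<close>, with weight
  \<open>d\<close> each.\<close>

theorem card_irreducibles_in_class_superlinear:
  "\<forall>\<^sub>F d in sequentially. K * d \<le> card (irreducibles_in_class g h d)"
proof -
  let ?q = "real CARD('a)"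
  define n where "n = card (poly_chars g)"
  define E where "E d = (\<Sum>\<chi>\<in>poly_chars g - {principal_char g}. norm (completely_multiplicative.prime_power_sum \<chi> d))" for d
  obtain B where B: "\<And>d. d \<ge> 1 \<Longrightarrow>
      Re (completely_multiplicative.prime_power_sum (principal_char g) d) \<ge> real (CARD('a) ^ d) - B"
    using principal_prime_power_sum_ge by blast
  have lower: "real n * real (class_weight g h d) \<ge> ?q ^ d - B - E d" if d: "d \<ge> 1" for d
  proof -
    let ?S = "\<lambda>\<chi>. completely_multiplicative.prime_power_sum \<chi> d"
    have "real n * real (class_weight g h d) = Re (\<Sum>\<chi>\<in>poly_chars g. cnj (\<chi> h) * ?S \<chi>)"
      unfolding class_weight_eq_sum_chars[symmetric] by (simp add: n_def flip: of_nat_mult)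
    also have "(\<Sum>\<chi>\<in>poly_chars g. cnj (\<chi> h) * ?S \<chi>) =
        ?S (principal_char g) + (\<Sum>\<chi>\<in>poly_chars g - {principal_char g}. cnj (\<chi> h) * ?S \<chi>)"
      using h by (simp add: sum.remove[OF finite_poly_chars[OF g] principal_char_in_poly_chars[OF g]] principal_char_def)
    also have "Re \<dots> \<ge> (?q ^ d - B) - E d"
    proof -
      let ?R = "\<Sum>\<chi>\<in>poly_chars g - {principal_char g}. cnj (\<chi> h) * ?S \<chi>"
      have "norm ?R \<le> (\<Sum>\<chi>\<in>poly_chars g - {principal_char g}. norm (cnj (\<chi> h) * ?S \<chi>))"
        by (rule norm_sum)
      also have "\<dots> = E d"
        unfolding E_def by (intro sum.cong refl) (use norm_poly_char[OF g _ h] in \<open>simp add: norm_mult\<close>)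
      finally have "- E d \<le> Re ?R" using abs_Re_le_cmod[of ?R] by linarith
      then show ?thesis using B[OF d] by simp
    qed
    finally show ?thesis by simp
  qed
  have upper: "real (class_weight g h d) \<le>
      real d * real (card (irreducibles_in_class g h d)) + real d * (real d + 1) * ?q ^ (d div 2)" for d
  proof -
    have "real (class_weight g h d) \<le>
       real (d * card (irreducibles_in_class g h d) + d * (d + 1) * CARD('a) ^ (d div 2))"
      using class_weight_le[of g h d] by (simp only: of_nat_le_iff)
    then show ?thesis by (simp add: algebra_simps)
  qed
  have q2: "?q \<ge> 2"
  proof -
    have "card {0, 1 :: 'a} \<le> CARD('a)" by (intro card_mono) auto
    then show ?thesis by simp
  qed
  \<comment> \<open>With \<open>y = q^(-1/4)\<close> the error \<open>d^2 q^(-d/2)\<close> is the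
    square of \<open>d y^d\<close>, whose limit 0 is standard.\<close>
  define y where "y = sqrt (sqrt (1 / ?q))"
  have y: "0 < y" "y < 1" "(y\<^sup>2)\<^sup>2 = 1 / ?q" using q2 by (auto simp: y_def)
  have poly_limit: "(\<lambda>d. (real d * y ^ d)\<^sup>2) \<longlonglongrightarrow> 0"
    using powser_times_n_limit_0[of y] y by (intro tendsto_null_power) auto
  have half: "?q ^ (d div 2) / ?q ^ d \<le> (y ^ d)\<^sup>2" for d
  proof -
    have eq: "(y ^ d)\<^sup>2 = (y\<^sup>2) ^ d" by (simp add: power_mult[symmetric] mult.commute)
    have y2: "0 < y\<^sup>2" "y\<^sup>2 < 1" using y by (auto simp: power_less_one_iff)
    have "?q ^ d = ?q ^ (d div 2) * ?q ^ (d - d div 2)" by (simp flip: power_add)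
    then have "?q ^ (d div 2) / ?q ^ d = (1 / ?q) ^ (d - d div 2)"
      using q2 by (simp add: power_divide)
    also have "\<dots> = (y\<^sup>2) ^ (2 * (d - d div 2))" by (simp add: y(3)[symmetric] power_mult)
    also have "\<dots> \<le> (y\<^sup>2) ^ d" using y2 by (intro power_decreasing) auto
    finally show ?thesis using eq by simp
  qed
  \<comment> \<open>Chosen so that \<open>F d < q^d\<close>, combined with \<open>lower\<close> and
    \<open>upper\<close>, gives \<open>K d^2 < d\<close> times the number of irreducibles.\<close>
  define F where "F d = real n * (real K * real d ^ 2 + real d * (real d + 1) * ?q ^ (d div 2)) + B + E d" for d
  have E_lim: "(\<lambda>d. E d / ?q ^ d) \<longlonglongrightarrow> 0"
  proof -
    have "(\<lambda>d. \<Sum>\<chi>\<in>poly_chars g - {principal_char g}.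
        norm (completely_multiplicative.prime_power_sum \<chi> d) / real (CARD('a) ^ d)) \<longlonglongrightarrow> 0"
      by (rule tendsto_null_sum) (rule nonprincipal_prime_power_sum_tendsto_0, auto)
    then show ?thesis by (simp add: E_def sum_divide_distrib)
  qed
  have B_lim: "(\<lambda>d. B / ?q ^ d) \<longlonglongrightarrow> 0"
  proof -
    have "(\<lambda>d. B * (1 / ?q) ^ d) \<longlonglongrightarrow> 0"
      using q2 by (intro tendsto_mult_right_zero LIMSEQ_realpow_zero) auto
    then show ?thesis by (simp add: power_divide)
  qed
  have bound: "F d / ?q ^ d \<le> real n * ((real K + 2) * (real d * y ^ d)\<^sup>2) + B / ?q ^ d + E d / ?q ^ d"
    if "d \<ge> 1" for d
  proof -
    have "real K * real d ^ 2 + real d * (real d + 1) * ?q ^ (d div 2) \<le> (real K + 2) * real d ^ 2 * ?q ^ (d div 2)"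
    proof -
      have "1 \<le> ?q ^ (d div 2)" using q2 by (intro one_le_power) auto
      then have "real K * real d ^ 2 * 1 \<le> real K * real d ^ 2 * ?q ^ (d div 2)"
        by (intro mult_left_mono) auto
      moreover have "real d * (real d + 1) \<le> 2 * real d ^ 2"
        using that by (simp add: power2_eq_square algebra_simps)
      then have "real d * (real d + 1) * ?q ^ (d div 2) \<le> 2 * real d ^ 2 * ?q ^ (d div 2)"
        by (rule mult_right_mono) simp
      ultimately show ?thesis by (simp add: algebra_simps)
    qed
    then have "(real K * real d ^ 2 + real d * (real d + 1) * ?q ^ (d div 2)) / ?q ^ d \<le>
        (real K + 2) * real d ^ 2 * ?q ^ (d div 2) / ?q ^ d"
      by (rule divide_right_mono) simp
    also have "\<dots> = (real K + 2) * real d ^ 2 * (?q ^ (d div 2) / ?q ^ d)" by simp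
    also have "\<dots> \<le> (real K + 2) * real d ^ 2 * (y ^ d)\<^sup>2"
      by (rule mult_left_mono[OF half]) simp
    also have "\<dots> = (real K + 2) * (real d * y ^ d)\<^sup>2" by (simp add: power_mult_distrib)
    finally have "real n * ((real K * real d ^ 2 + real d * (real d + 1) * ?q ^ (d div 2)) / ?q ^ d) \<le>
        real n * ((real K + 2) * (real d * y ^ d)\<^sup>2)" by (rule mult_left_mono) simp
    moreover have "F d / ?q ^ d =
        real n * ((real K * real d ^ 2 + real d * (real d + 1) * ?q ^ (d div 2)) / ?q ^ d) + B / ?q ^ d + E d / ?q ^ d"
      by (simp add: F_def add_divide_distrib distrib_left)
    ultimately show ?thesis by linarith
  qed
  have "(\<lambda>d. real n * ((real K + 2) * (real d * y ^ d)\<^sup>2) + B / ?q ^ d + E d / ?q ^ d) \<longlonglongrightarrow> 0"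
    by (intro tendsto_add_zero tendsto_mult_right_zero poly_limit B_lim E_lim)
  then have "\<forall>\<^sub>F d in sequentially. real n * ((real K + 2) * (real d * y ^ d)\<^sup>2) + B / ?q ^ d + E d / ?q ^ d < 1"
    by (rule order_tendstoD) simp
  then show ?thesis using eventually_ge_at_top[of "1::nat"]
  proof eventually_elim
    case (elim d)
    then have "F d / ?q ^ d < 1" using bound[of d] by linarith
    then have F: "F d < ?q ^ d" using q2 by (simp add: divide_less_eq)
    have n0: "real n > 0"
      using finite_poly_chars[OF g] principal_char_in_poly_chars[OF g] by (auto simp: n_def card_gt_0_iff)
    have "real n * (real K * real d ^ 2 + real d * (real d + 1) * ?q ^ (d div 2)) < real n * real (class_weight g h d)"
      using F lower[of d] elim(2) by (simp add: F_def)
    then have "real K * real d ^ 2 + real d * (real d + 1) * ?q ^ (d div 2) < real (class_weight g h d)"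
      using n0 by simp
    then have "real K * real d ^ 2 < real d * real (card (irreducibles_in_class g h d))"
      using upper[of d] by linarith
    then have "real d * (real K * real d) < real d * real (card (irreducibles_in_class g h d))"
      by (simp add: power2_eq_square mult_ac)
    then have "real K * real d < real (card (irreducibles_in_class g h d))"
      using elim(2) by simp
    then have "real (K * d) < real (card (irreducibles_in_class g h d))" by simp
    then show ?case by (simp only: of_nat_less_iff less_imp_le)
  qed
qed

end

section \<open>Carmichael polynomials\<close>

text \<open>Modulo an irreducible \<open>p\<close> all nonzero residues are units, so the unit group
  has \<open>q ^ degree p - 1\<close> elements and Euler's theorem applies.\<close>

lemma fermat_poly:
  fixes p :: "'a::{field,finite} poly"
  assumes "irreducible p"
  shows "(a ^ CARD('a) ^ degree p) mod p = a mod p"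
proof (cases "p dvd a")
  case True
  then have "p dvd a ^ CARD('a) ^ degree p" by (simp add: dvd_power_le dvd_trans[OF _ dvd_power])
  then show ?thesis using True by (simp add: mod_eq_0_iff_dvd[symmetric] dvd_imp_mod_0)
next
  case False
  have p: "p \<noteq> 0" "\<not> is_unit p" using assms unfolding irreducible_def by blast+
  have cop: "coprime r p \<longleftrightarrow> r \<noteq> 0" if "r \<in> quot_carrier p" for r
  proof (cases "r = 0")
    case False
    have "\<not> p dvd r" using that False by (auto simp: quot_carrier_def dvd_eq_mod_eq_0)
    then have "coprime p r" by (rule irreducible_imp_coprime[OF assms])
    then show ?thesis using False by (simp add: coprime_commute)
  qed (use p in simp)
  have "carrier (unit_group p) = quot_carrier p - {0}"
    using cop by (auto simp: unit_group_def)
  moreover have "0 \<in> quot_carrier p" by (simp add: quot_carrier_def)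
  ultimately have "Suc (card (carrier (unit_group p))) = CARD('a) ^ degree p"
    using finite_quot_carrier[OF p(1)] card_quot_carrier[OF p(1)] by (metis card.remove)
  moreover have "coprime a p" using irreducible_imp_coprime[OF assms False] by (simp add: coprime_commute)
  then have "(a * a ^ card (carrier (unit_group p))) mod p = a mod p"
    using euler_theorem_poly[OF p(1)] by (metis mod_mult_right_eq mult.right_neutral)
  ultimately show ?thesis by (metis power_Suc)
qed

lemma fermat_poly_multiple:
  fixes p :: "'a::{field,finite} poly"
  assumes "irreducible p" "degree p dvd n"
  shows "(a ^ CARD('a) ^ n) mod p = a mod p"
proof -
  obtain k where n: "n = degree p * k" using assms(2) by auto
  have "(a ^ CARD('a) ^ (degree p * k)) mod p = a mod p"
  proof (induction k)
    case (Suc k)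
    have "(a ^ CARD('a) ^ (degree p * Suc k)) mod p = ((a ^ CARD('a) ^ (degree p * k)) ^ CARD('a) ^ degree p) mod p"
      by (simp add: power_add mult.commute flip: power_mult)
    also have "\<dots> = (a ^ CARD('a) ^ (degree p * k)) mod p" by (rule fermat_poly[OF assms(1)])
    finally show ?case using Suc by simp
  qed simp
  then show ?thesis using n by simp
qed

text \<open>Split off one irreducible factor \<open>p\<close>. The cofactor divides \<open>b\<close>
  by induction and is not divisible by \<open>p\<close>, so \<open>p\<close> divides the remaining
  quotient.\<close>

lemma squarefree_dvdI:
  fixes f :: "'a::{field,finite} poly"
  assumes "f \<noteq> 0" "squarefree f" "\<And>p. monic_irreducible p \<Longrightarrow> p dvd f \<Longrightarrow> p dvd b"
  shows "f dvd b"
  using assms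
proof (induction "degree f" arbitrary: f rule: less_induct)
  case less
  show ?case
  proof (cases "degree f = 0")
    case True
    then show ?thesis using less.prems(1) is_unit_iff_degree[of f] unit_imp_dvd by blast
  next
    case False
    then obtain p where p: "monic_irreducible p" "p dvd f"
      using exists_monic_irreducible_dvd by blast
    obtain f' where f: "f = p * f'" using p(2) by (rule dvdE)
    have f'0: "f' \<noteq> 0" using f less.prems(1) by auto
    have "\<not> p dvd f'"
    proof
      assume "p dvd f'"
      then have "p\<^sup>2 dvd f" unfolding f power2_eq_square by (rule mult_dvd_mono[OF dvd_refl])
      then show False
        using less.prems(2) monic_irreducible_not_unit[OF p(1)] unfolding squarefree_def by blast
    qed
    have "degree f' < degree f"
      using f f'0 monic_irreducible_nonzero[OF p(1)] monic_irreducible_degree_pos[OF p(1)]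
      by (simp add: degree_mult_eq)
    moreover have "squarefree f'"
      using less.prems(2) unfolding squarefree_def f by (blast intro: dvd_mult)
    moreover have "q dvd b" if "monic_irreducible q" "q dvd f'" for q
      using less.prems(3)[OF that(1)] that(2) unfolding f by (blast intro: dvd_mult)
    ultimately have "f' dvd b" using less.hyps f'0 by blast
    then obtain c where c: "b = f' * c" by (rule dvdE)
    have "p dvd f' * c" using less.prems(3)[OF p] c by simp
    then have "p dvd c"
      using \<open>\<not> p dvd f'\<close> prime_elem_dvd_mult_iff[OF monic_irreducible_prime_elem[OF p(1)]] by blast
    then show ?thesis unfolding f c by (metis dvd_refl mult.commute mult_dvd_mono)
  qed
qed

text \<open>Korselt's criterion: the quotient has \<open>CARD('a) ^ degree f\<close> elements, so
  Fermat's theorem gives the identity modulo each irreducible factor, and square-freeness combines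
  them. The proper divisor \<open>q\<close> is a nonzero residue without inverse, which excludes a
  field.\<close>

lemma carmichael_polyI:
  fixes f :: "'a::{field,finite} poly"
  assumes f: "f \<noteq> 0" "squarefree f"
    and deg: "\<And>p. monic_irreducible p \<Longrightarrow> p dvd f \<Longrightarrow> degree p dvd degree f"
    and q: "q dvd f" "0 < degree q" "degree q < degree f"
  shows "carmichael_poly f"
  unfolding carmichael_poly_def
proof (intro conjI allI)
  show "f \<noteq> 0" by fact
  show "\<not> quot_is_field f"
  proof
    assume "quot_is_field f"
    moreover have "q mod f \<noteq> 0" using q by (auto simp: mod_poly_less)
    ultimately obtain b where "(q * b) mod f = 1 mod f" unfolding quot_is_field_def by blast
    then have "f dvd q * b - 1" by (simp add: mod_eq_dvd_iff)
    then have "q dvd q * b - 1" using q(1) by (rule dvd_trans[rotated])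
    then have "q dvd q * b - (q * b - 1)" by (rule dvd_diff[OF dvd_triv_left])
    then have "is_unit q" by simp
    moreover have "q \<noteq> 0" using q(2) by auto
    ultimately show False using q(2) is_unit_iff_degree[of q] by simp
  qed
  fix a
  have "f dvd a ^ card (quot_carrier f) - a"
  proof (rule squarefree_dvdI[OF f])
    fix p assume p: "monic_irreducible p" "p dvd f"
    have "(a ^ CARD('a) ^ degree f) mod p = a mod p"
      using fermat_poly_multiple[OF _ deg[OF p]] p by (simp add: monic_irreducible_def)
    then show "p dvd a ^ card (quot_carrier f) - a"
      unfolding card_quot_carrier[OF f(1)] by (simp add: mod_eq_dvd_iff)
  qed
  then show "(a ^ card (quot_carrier f)) mod f = a mod f" by (simp add: mod_eq_dvd_iff)
qed

section \<open>Construction of the cofactor \<open>w\<close>\<close>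

lemma squarefree_mult_monic_irreducible:
  assumes "squarefree x" "monic_irreducible p" "\<not> p dvd x"
  shows "squarefree (p * x)"
  unfolding squarefree_def
proof (intro allI impI)
  fix y assume y: "y\<^sup>2 dvd p * x"
  have p0: "p \<noteq> 0" and pr: "prime_elem p"
    using assms(2) by (simp_all add: monic_irreducible_nonzero monic_irreducible_prime_elem)
  have "\<not> p dvd y"
  proof
    assume "p dvd y"
    then have "p * p dvd p * x" using y unfolding power2_eq_square by (metis dvd_trans mult_dvd_mono)
    then show False using p0 assms(3) by simp
  qed
  obtain c where c: "p * x = y\<^sup>2 * c" using y by (rule dvdE)
  then have "p dvd y\<^sup>2 * c" by (metis dvd_triv_left)
  then have "p dvd c"
    using \<open>\<not> p dvd y\<close> pr unfolding power2_eq_square by (simp add: prime_elem_dvd_mult_iff)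
  then obtain c' where "c = p * c'" by (rule dvdE)
  then have "p * x = p * (y\<^sup>2 * c')" using c by (simp add: mult_ac)
  then have "y\<^sup>2 dvd x" using p0 by simp
  then show "is_unit y" using assms(1) unfolding squarefree_def by blast
qed

text \<open>The factor \<open>u\<close> lets the same statement serve for \<open>u * w\<close> and,
  with \<open>u = 1\<close>, for \<open>w\<close>.\<close>

lemma monic_irreducible_dvd_mult_prod:
  assumes "finite A" "\<And>q. q \<in> A \<Longrightarrow> monic_irreducible q" "monic_irreducible p" "p dvd u * \<Prod>A"
  shows "p dvd u \<or> p \<in> A"
  using assms(1,2,4)
proof (induction A rule: finite_induct)
  case (insert q A)
  have "p dvd q * (u * \<Prod>A)" using insert by (simp add: mult_ac)
  then consider "p dvd q" | "p dvd u * \<Prod>A"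
    using prime_elem_dvd_mult_iff[OF monic_irreducible_prime_elem[OF assms(3)]] by blast
  then show ?case
    using insert monic_irreducible_dvd_imp_eq[OF assms(3)] by cases auto
qed simp

lemma squarefree_mult_prod:
  assumes "squarefree u" "finite A" "\<And>q. q \<in> A \<Longrightarrow> monic_irreducible q" "\<And>q. q \<in> A \<Longrightarrow> \<not> q dvd u"
  shows "squarefree (u * \<Prod>A)"
  using assms(2,3,4)
proof (induction A rule: finite_induct)
  case (insert q A)
  have "\<not> q dvd u * \<Prod>A"
    using monic_irreducible_dvd_mult_prod[of A q u] insert by blast
  then have "squarefree (q * (u * \<Prod>A))"
    using insert squarefree_mult_monic_irreducible[of "u * \<Prod>A" q] by blast
  then show ?case using insert by (simp add: mult_ac)
qed (use assms(1) in simp)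

text \<open>Divide \<open>R = D d (d + 1) - n\<close> by \<open>d\<close> and absorb the remainder
  \<open>b\<close> by lengthening \<open>b\<close> of the parts from \<open>d\<close> to
  \<open>d + 1\<close>. The quotient is at least \<open>d > b\<close> because
  \<open>R \<ge> d^2\<close>, so some part of length \<open>d\<close> is left. The upper bound on
  \<open>a\<close> matches the supply of irreducibles.\<close>

lemma consecutive_representation:
  fixes d n D :: nat
  assumes "d > n" "d \<ge> 2" "D \<ge> 1"
  obtains a b where "n + (a * d + b * (d + 1)) = D * d * (d + 1)" "1 \<le> a" "a \<le> 2 * D * d" "b < d"
proof
  define R where "R = D * d * (d + 1) - n"
  define b where "b = R mod d"
  define a where "a = R div d - b"
  have "d * d + d \<le> D * d * (d + 1)"
    using mult_le_mono1[OF assms(3), of "d * (d + 1)"] by (simp add: algebra_simps)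
  then have R: "n + R = D * d * (d + 1)" "R \<ge> d * d" using assms by (auto simp: R_def)
  have "R div d \<ge> d" using R(2) assms(2) by (simp add: less_eq_div_iff_mult_less_eq)
  moreover show "b < d" using assms by (simp add: b_def)
  ultimately have ab: "R div d = a + b" "1 \<le> a" by (auto simp: a_def)
  show "1 \<le> a" by fact
  have "R = (a + b) * d + b" by (subst ab(1)[symmetric]) (simp add: b_def)
  then show "n + (a * d + b * (d + 1)) = D * d * (d + 1)" using R(1) by (simp add: algebra_simps)
  have "n + R = D * (d + 1) * d" using R(1) by (simp only: mult_ac)
  then have "R \<le> D * (d + 1) * d" by linarith
  then have "R div d \<le> D * (d + 1)" using assms(2) by (metis div_le_mono div_mult_self_is_m not_numeral_le_zero neq0_conv)
  also have "\<dots> \<le> D * (2 * d)" using assms(2) by (intro mult_le_mono2) simp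
  finally show "a \<le> 2 * D * d" using ab(1) by (simp add: mult_ac)
qed

lemma carmichael_multiples_unbounded:
  fixes u g h :: "'a::{field,finite} poly"
  assumes u: "u \<noteq> 0" "squarefree u" and g: "g \<noteq> 0" "coprime h g"
  obtains w where "degree w \<ge> N" "squarefree w" "lead_coeff w = 1"
    "\<And>p. monic_irreducible p \<Longrightarrow> p dvd w \<Longrightarrow> p mod g = h mod g" "carmichael_poly (u * w)"
proof -
  \<comment> \<open>The factorial is divisible by the degree of every irreducible factor of
    \<open>u\<close>.\<close>
  define D :: nat where "D = fact (degree u)"
  have D: "D \<ge> 1" by (simp add: D_def)
  obtain d0 where d0: "\<And>d. d \<ge> d0 \<Longrightarrow> 2 * D * d \<le> card (irreducibles_in_class g h d)"
    using card_irreducibles_in_class_superlinear[OF g, of "2 * D"] unfolding eventually_sequentially by blast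
  \<comment> \<open>\<open>d > degree u\<close> keeps the new factors from dividing
    \<open>u\<close>; \<open>d \<ge> N\<close> makes \<open>w\<close> long enough, since at least
    one factor has degree \<open>d\<close>.\<close>
  define d where "d = Max {d0, N, degree u + 1, 2}"
  have d: "d \<ge> d0" "d \<ge> N" "d > degree u" "d \<ge> 2" by (auto simp: d_def)
  obtain a b where ab: "degree u + (a * d + b * (d + 1)) = D * d * (d + 1)" "1 \<le> a" "a \<le> 2 * D * d" "b < d"
    using consecutive_representation[OF d(3,4) D] by blast
  have "a \<le> card (irreducibles_in_class g h d)" using ab(3) d0[OF d(1)] by (rule order_trans)
  then obtain A where A: "A \<subseteq> irreducibles_in_class g h d" "card A = a"
    using obtain_subset_with_card_n by metis
  have "b \<le> 2 * D * (d + 1)" using ab(4) D mult_le_mono1[of 1 "2 * D" "d + 1"] by simp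
  also have "\<dots> \<le> card (irreducibles_in_class g h (d + 1))" using d(1) by (intro d0) simp
  finally obtain B where B: "B \<subseteq> irreducibles_in_class g h (d + 1)" "card B = b"
    using obtain_subset_with_card_n by metis
  have fin: "finite A" "finite B"
    using A(1) B(1) finite_irreducibles_in_class finite_subset by blast+
  have degA: "degree q = d" if "q \<in> A" for q
    using that A(1) by (auto simp: irreducibles_in_class_def)
  have degB: "degree q = d + 1" if "q \<in> B" for q
    using that B(1) by (auto simp: irreducibles_in_class_def)
  have disj: "A \<inter> B = {}"
  proof (rule ccontr)
    assume "A \<inter> B \<noteq> {}"
    then obtain q where "q \<in> A" "q \<in> B" by blast
    then show False using degA[of q] degB[of q] by simp
  qed
  have irr: "monic_irreducible q" "q mod g = h mod g" "degree q = d \<or> degree q = d + 1" if "q \<in> A \<union> B" for q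
    using that A(1) B(1) by (auto simp: irreducibles_in_class_def)
  have ndvd: "\<not> q dvd u" if "q \<in> A \<union> B" for q
    using irr(3)[OF that] d(3) dvd_imp_degree_le[of q u] u(1) by auto
  define w where "w = \<Prod>(A \<union> B)"
  have "degree w = (\<Sum>q\<in>A \<union> B. degree q)"
    unfolding w_def using irr(1) monic_irreducible_nonzero by (intro degree_prod_eq_sum_degree) auto
  also have "\<dots> = (\<Sum>q\<in>A. degree q) + (\<Sum>q\<in>B. degree q)"
    using fin disj by (rule sum.union_disjoint)
  also have "(\<Sum>q\<in>A. degree q) = (\<Sum>q\<in>A. d)"
    using degA by simp
  also have "(\<Sum>q\<in>B. degree q) = (\<Sum>q\<in>B. d + 1)"
    using degB by simp
  finally have degw: "degree w = a * d + b * (d + 1)" by (simp add: A(2) B(2))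
  have lead: "lead_coeff w = 1"
    unfolding w_def lead_coeff_prod using irr(1) by (intro prod.neutral) (simp add: monic_irreducible_def)
  then have w0: "w \<noteq> 0" by auto
  have deguw: "degree (u * w) = D * d * (d + 1)" using u(1) w0 degw ab(1) by (simp add: degree_mult_eq)
  have sq: "squarefree (u * w)"
    unfolding w_def using u(2) fin irr(1) ndvd by (intro squarefree_mult_prod) auto
  have dvd_uw: "p dvd u \<or> p \<in> A \<union> B" if "monic_irreducible p" "p dvd u * w" for p
    using monic_irreducible_dvd_mult_prod[of "A \<union> B" p u] that fin irr(1) unfolding w_def by blast
  have dvd_w: "p \<in> A \<union> B" if "monic_irreducible p" "p dvd w" for p
    using monic_irreducible_dvd_mult_prod[of "A \<union> B" p 1] that fin irr(1) monic_irreducible_not_unit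
    unfolding w_def by auto
  show ?thesis
  proof (rule that)
    have "1 * d \<le> a * d" using ab(2) by (rule mult_le_mono1)
    then show "degree w \<ge> N" using d(2) unfolding degw by linarith
    show "squarefree w" using sq unfolding squarefree_def by (blast intro: dvd_mult)
    show "lead_coeff w = 1" by fact
    show "p mod g = h mod g" if "monic_irreducible p" "p dvd w" for p
      using dvd_w[OF that] irr(2) by blast
    \<comment> \<open>\<open>a \<ge> 1\<close> supplies a factor of degree \<open>d\<close>, smaller
      than the total degree \<open>D d (d + 1)\<close>: the proper divisor that excludes a
      field.\<close>
    obtain q where q: "q \<in> A" using ab(2) A(2) by fastforce
    show "carmichael_poly (u * w)"
    proof (rule carmichael_polyI[OF _ sq, where q = q])
      show "u * w \<noteq> 0" using u(1) w0 by simp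
      show "degree p dvd degree (u * w)" if p: "monic_irreducible p" "p dvd u * w" for p
        using dvd_uw[OF p]
      proof
        assume "p dvd u"
        then have "degree p \<le> degree u" using u(1) by (rule dvd_imp_degree_le)
        then have "degree p dvd D"
          unfolding D_def using monic_irreducible_degree_pos[OF p(1)] by (intro dvd_fact) auto
        then show ?thesis unfolding deguw by (simp add: dvd_mult2)
      next
        assume "p \<in> A \<union> B"
        then have "degree p = d \<or> degree p = d + 1" by (rule irr(3))
        then show ?thesis unfolding deguw by (metis dvd_mult2 dvd_triv_right)
      qed
      show "q dvd u * w" unfolding w_def using fin q by (intro dvd_mult dvd_prodI) auto
      show "0 < degree q" using d(4) degA[OF q] by simp
      have "1 * (d * 1) < D * (d * (d + 1))"
        using D d(4) by (intro mult_le_less_imp_less mult_strict_left_mono) auto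
      then show "degree q < degree (u * w)" unfolding deguw degA[OF q] by (simp only: mult.assoc mult_1 mult_1_right)
    qed
  qed
qed

theorem theorem4p2:
  fixes u g h :: "'a::{field,finite} poly"
  assumes "u \<noteq> 0" and "squarefree u"
    and "g \<noteq> 0" and "coprime g h"
  shows "infinite {w. squarefree w \<and> lead_coeff w = 1 \<and>
            (\<forall>p. irreducible p \<and> lead_coeff p = 1 \<and> p dvd w \<longrightarrow> p mod g = h mod g) \<and>
            carmichael_poly (u * w)}"
    (is "infinite ?W")
proof
  assume fin: "finite ?W"
  have "coprime h g" using assms(4) by (simp add: coprime_commute)
  \<comment> \<open>A member of a finite set cannot have a degree above the sum of the degrees of
    all members.\<close>
  then obtain w where w: "degree w \<ge> Suc (\<Sum>v\<in>?W. degree v)" "squarefree w" "lead_coeff w = 1"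
      "\<And>p. monic_irreducible p \<Longrightarrow> p dvd w \<Longrightarrow> p mod g = h mod g" "carmichael_poly (u * w)"
    using carmichael_multiples_unbounded[OF assms(1,2,3)] by blast
  then have "w \<in> ?W" by (simp add: monic_irreducible_def)
  then have "degree w \<le> (\<Sum>v\<in>?W. degree v)" using fin by (intro member_le_sum) auto
  then show False using w(1) by simp
qed

end
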